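(* Let $S$ be a cancellative and right amenable monoid and $G=S^{-1}S$ its group of left fractions. (1) Given a left $S$-action $\lambda$ on a discrete Abelian group $X$, let $K=X^\wedge$ and let $\rho=\lambda^\wedge$ be the dual right $S$-action on $K$. Then the dual of the Ore localization $\lambda^*$ (a left $G$-action on $X^*$) is conjugated to the Ore colocalization $\rho^*$ (a right $G$-action on $K^*$). (2) Given a right $S$-action $\rho$ on a compact (Hausdorff) Abelian group $K$ by continuous endomorphisms, let $X=K^\wedge$ and let $\lambda=\rho^\wedge$ be the dual left $S$-action on $X$. Then the dual of the Ore colocalization $\rho^*$ (on $K^*$) is conjugated to the Ore localization $\lambda^*$ (on $X^*$).
   Context: A cancellative monoid $S$ is right amenable if it admits a right F{\o}lner net, i.e. a net $\{F_i\}_{i\in I}$ of non-empty finite subsets of $S$ such that $\lim_{i\in I}|F_is\setminus F_i|/|F_i|=0$ for every $s\in S$. Such an $S$ satisfies the left Ore condition and so embeds in its group of left fractions $G=S^{-1}S$, in which every element has the form $s^{-1}t$ with $s,t\in S$. Preorder $G$ by $g_1\le_S g_2$ iff $g_2^{-1}g_1\in S$; this is directed. Left $S$-action $\lambda$ on an Abelian group $X$: endomorphisms $\lambda_s$ with $\lambda_1=\mathrm{id}$, $\lambda_{st}=\lambda_s\circ\lambda_t$. Right $S$-action $\rho$ on a compact Abelian group $K$: continuous endomorphisms $\rho_s$ with $\rho_1=\mathrm{id}$, $\rho_{st}=\rho_t\circ\rho_s$. Similarly for $G$. Two actions are conjugated if there is an equivariant (topological) group isomorphism between the underlying groups. Duality: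 $\Gamma^\wedge$ is the Pontryagin dual of a locally compact Abelian group $\Gamma$, $\phi^\wedge(\chi)=\chi\circ\phi$; the dual of a left action $\lambda$ on a discrete group is the right action $(\lambda^\wedge)_s=(\lambda_s)^\wedge$ on the compact dual, and the dual of a right action $\rho$ on a compact Abelian group is the left action $(\rho^\wedge)_s=(\rho_s)^\wedge$ on the discrete dual (same for $G$-actions). Ore localization of $\lambda$: let $\bar X=X/\bigcup_{s\in S}\mathrm{Ker}(\lambda_s)$ with induced action $\bar\lambda$; $X^*$ is the direct limit of the direct system indexed by $(G,\le_S)$ with $X_g=\bar X$ and transition maps $\bar\lambda_s\colon X_{gs}\to X_g$ ($g\in G,s\in S$), with canonical maps $\varepsilon_g\colon X_g\to X^*$; $\lambda^*$ is the unique left $G$-action on $X^*$ with $\lambda_g^*\circ\varepsilon_h=\varepsilon_{gh}$ for all $g,h\in G$. Ore colocalization of $\rho$: let $\bar K=\bigcap_{t\in S}\rho_t(K)$, $\bar\rho_s=\rho_s|_{\bar K}$; $K^*$ is the inverse limit of the inverse system indexed by $(G,\le_S)$ with $K_g=\bar K$ and transition maps $\bar\rho_s\colon K_g\to K_{gs}$, with canonical maps $\pi_g\colon K^*\to K_g$; $\rho^*$ is the right $G$-action on $K^*$ with $\pi_h\circ\rho^*_g=\pi_{gh}$ for all $g,h\in G$. *)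

theory Defs
  imports "HOL-Algebra.Divisibility" "HOL-Algebra.Product_Groups" "HOL-Analysis.Analysis"
begin

section \<open>Right amenable monoids and groups of left fractions\<close>

definition directed_preorder :: "'i set \<Rightarrow> ('i \<Rightarrow> 'i \<Rightarrow> bool) \<Rightarrow> bool" where
  "directed_preorder I below \<longleftrightarrow> I \<noteq> {} \<and> (\<forall>i\<in>I. below i i) \<and>
     (\<forall>i\<in>I. \<forall>j\<in>I. \<forall>k\<in>I. below i j \<longrightarrow> below j k \<longrightarrow> below i k) \<and>
     (\<forall>i\<in>I. \<forall>j\<in>I. \<exists>k\<in>I. below i k \<and> below j k)"

text \<open>The tail filter of a directed set, so that limits along the net are limits with respect to
  this filter.\<close>

definition net_filter :: "'i set \<Rightarrow> ('i \<Rightarrow> 'i \<Rightarrow> bool) \<Rightarrow> 'i filter" where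
  "net_filter I below = (INF i\<in>I. principal {j\<in>I. below i j})"

text \<open>A monoid is right amenable if it admits a right Folner net. The index set of the net may
  have any type, and a formula cannot quantify existentially over types; therefore the theorem
  takes the net itself as a hypothesis.\<close>

definition right_folner_net ::
    "('s, 'm) monoid_scheme \<Rightarrow> 'i set \<Rightarrow> ('i \<Rightarrow> 'i \<Rightarrow> bool) \<Rightarrow> ('i \<Rightarrow> 's set) \<Rightarrow> bool" where
  "right_folner_net S I below F \<longleftrightarrow> directed_preorder I below \<and>
     (\<forall>i\<in>I. finite (F i) \<and> F i \<noteq> {} \<and> F i \<subseteq> carrier S) \<and>
     (\<forall>s\<in>carrier S.
        ((\<lambda>i. real (card ((F i #>\<^bsub>S\<^esub> s) - F i)) / real (card (F i))) \<longlongrightarrow> 0) (net_filter I below))"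

text \<open>The group of left fractions of \<open>S\<close> is determined up to isomorphism over \<open>S\<close>, so it is
  given as any group with an embedding of \<open>S\<close> for which every element is a left fraction.\<close>

definition left_fraction_group ::
    "('s, 'm) monoid_scheme \<Rightarrow> ('g, 'n) monoid_scheme \<Rightarrow> ('s \<Rightarrow> 'g) \<Rightarrow> bool" where
  "left_fraction_group S G \<iota> \<longleftrightarrow> group G \<and> \<iota> \<in> hom S G \<and> inj_on \<iota> (carrier S) \<and>
     carrier G = {inv\<^bsub>G\<^esub> (\<iota> s) \<otimes>\<^bsub>G\<^esub> \<iota> t | s t. s \<in> carrier S \<and> t \<in> carrier S}"

definition fraction_le ::
    "('s, 'm) monoid_scheme \<Rightarrow> ('g, 'n) monoid_scheme \<Rightarrow> ('s \<Rightarrow> 'g) \<Rightarrow> 'g \<Rightarrow> 'g \<Rightarrow> bool" where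
  "fraction_le S G \<iota> g1 g2 \<longleftrightarrow> inv\<^bsub>G\<^esub> g2 \<otimes>\<^bsub>G\<^esub> g1 \<in> \<iota> ` carrier S"

text \<open>If \<open>g1\<close> lies below \<open>g2\<close>, this is the unique \<open>s\<close> in \<open>S\<close> with \<open>g1 = g2 s\<close>.\<close>

definition fraction_quotient ::
    "('s, 'm) monoid_scheme \<Rightarrow> ('g, 'n) monoid_scheme \<Rightarrow> ('s \<Rightarrow> 'g) \<Rightarrow> 'g \<Rightarrow> 'g \<Rightarrow> 's" where
  "fraction_quotient S G \<iota> g1 g2 = inv_into (carrier S) \<iota> (inv\<^bsub>G\<^esub> g2 \<otimes>\<^bsub>G\<^esub> g1)"


section \<open>Topological Abelian groups and actions\<close>

text \<open>Abelian groups are written multiplicatively, as in \<open>HOL-Algebra\<close>.\<close>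

record 'a top_group = "'a monoid" +
  tp :: "'a topology"

definition topological_ab_group :: "'a top_group \<Rightarrow> bool" where
  "topological_ab_group K \<longleftrightarrow> comm_group K \<and> topspace (tp K) = carrier K \<and>
     continuous_map (prod_topology (tp K) (tp K)) (tp K) (\<lambda>(x, y). x \<otimes>\<^bsub>K\<^esub> y) \<and>
     continuous_map (tp K) (tp K) (\<lambda>x. inv\<^bsub>K\<^esub> x)"

definition compact_ab_group :: "'a top_group \<Rightarrow> bool" where
  "compact_ab_group K \<longleftrightarrow>
     topological_ab_group K \<and> compact_space (tp K) \<and> Hausdorff_space (tp K)"

definition discrete_group :: "('a, 'm) monoid_scheme \<Rightarrow> 'a top_group" where
  "discrete_group X = \<lparr>carrier = carrier X, monoid.mult = (\<otimes>\<^bsub>X\<^esub>), monoid.one = \<one>\<^bsub>X\<^esub>,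
                 tp = discrete_topology (carrier X)\<rparr>"

definition left_action ::
    "('s, 'm) monoid_scheme \<Rightarrow> ('x, 'n) monoid_scheme \<Rightarrow> ('s \<Rightarrow> 'x \<Rightarrow> 'x) \<Rightarrow> bool" where
  "left_action S X lam \<longleftrightarrow>
     (\<forall>s\<in>carrier S. lam s \<in> hom X X) \<and>
     (\<forall>x\<in>carrier X. lam \<one>\<^bsub>S\<^esub> x = x) \<and>
     (\<forall>s\<in>carrier S. \<forall>t\<in>carrier S. \<forall>x\<in>carrier X. lam (s \<otimes>\<^bsub>S\<^esub> t) x = lam s (lam t x))"

definition right_action ::
    "('s, 'm) monoid_scheme \<Rightarrow> 'k top_group \<Rightarrow> ('s \<Rightarrow> 'k \<Rightarrow> 'k) \<Rightarrow> bool" where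
  "right_action S K \<rho> \<longleftrightarrow>
     (\<forall>s\<in>carrier S. \<rho> s \<in> hom K K \<and> continuous_map (tp K) (tp K) (\<rho> s)) \<and>
     (\<forall>x\<in>carrier K. \<rho> \<one>\<^bsub>S\<^esub> x = x) \<and>
     (\<forall>s\<in>carrier S. \<forall>t\<in>carrier S. \<forall>x\<in>carrier K. \<rho> (s \<otimes>\<^bsub>S\<^esub> t) x = \<rho> t (\<rho> s x))"

text \<open>The equivariance condition is the same for left and for right actions.\<close>

definition conjugated ::
    "('g, 'n) monoid_scheme \<Rightarrow> 'a top_group \<Rightarrow> ('g \<Rightarrow> 'a \<Rightarrow> 'a) \<Rightarrow>
     'b top_group \<Rightarrow> ('g \<Rightarrow> 'b \<Rightarrow> 'b) \<Rightarrow> bool" where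
  "conjugated G A \<alpha> B \<beta> \<longleftrightarrow>
     (\<exists>f. f \<in> iso A B \<and> homeomorphic_map (tp A) (tp B) f \<and>
          (\<forall>g\<in>carrier G. \<forall>x\<in>carrier A. f (\<alpha> g x) = \<beta> g (f x)))"


section \<open>Pontryagin duality\<close>

definition circle :: "complex top_group" where
  "circle = \<lparr>carrier = sphere 0 1, monoid.mult = (*), monoid.one = 1, tp = top_of_set (sphere 0 1)\<rparr>"

text \<open>Characters are made extensional, so that equality of characters is equality on the
  carrier.\<close>

definition characters :: "'a top_group \<Rightarrow> ('a \<Rightarrow> complex) set" where
  "characters A =
     {\<xi> \<in> extensional (carrier A). \<xi> \<in> hom A circle \<and> continuous_map (tp A) (tp circle) \<xi>}"

text \<open>The Pontryagin dual: pointwise multiplication and the compact-open topology. The choice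
  \<open>C = {}\<close> below gives the whole set of characters, which is thus the underlying set of the
  topology.\<close>

definition dual :: "'a top_group \<Rightarrow> ('a \<Rightarrow> complex) top_group" where
  "dual A = \<lparr>carrier = characters A,
     monoid.mult = (\<lambda>\<xi> \<eta>. \<lambda>x\<in>carrier A. \<xi> x \<otimes>\<^bsub>circle\<^esub> \<eta> x),
     monoid.one = (\<lambda>x\<in>carrier A. \<one>\<^bsub>circle\<^esub>),
     tp = topology_generated_by
            {{\<xi> \<in> characters A. \<xi> ` C \<subseteq> U} | C U. compactin (tp A) C \<and> openin (tp circle) U}\<rparr>"

definition dual_action ::
    "'a top_group \<Rightarrow> ('s \<Rightarrow> 'a \<Rightarrow> 'a) \<Rightarrow> 's \<Rightarrow> ('a \<Rightarrow> complex) \<Rightarrow> ('a \<Rightarrow> complex)" where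
  "dual_action A \<alpha> s \<xi> = compose (carrier A) \<xi> (\<alpha> s)"


section \<open>Direct and inverse limits\<close>

text \<open>Direct limits over a directed preorder: \<open>f i j\<close>, for \<open>i\<close> below \<open>j\<close>, is the transition map
  from \<open>A i\<close> to \<open>A j\<close>. The limit is the disjoint union of the groups modulo eventual equality.\<close>

definition direct_limit_rel ::
    "'i set \<Rightarrow> ('i \<Rightarrow> 'i \<Rightarrow> bool) \<Rightarrow> ('i \<Rightarrow> ('a, 'm) monoid_scheme) \<Rightarrow> ('i \<Rightarrow> 'i \<Rightarrow> 'a \<Rightarrow> 'a) \<Rightarrow>
     (('i \<times> 'a) \<times> ('i \<times> 'a)) set" where
  "direct_limit_rel I below A f =
     {((i, x), (j, y)). i \<in> I \<and> j \<in> I \<and> x \<in> carrier (A i) \<and> y \<in> carrier (A j) \<and>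
        (\<exists>k\<in>I. below i k \<and> below j k \<and> f i k x = f j k y)}"

definition direct_limit_map ::
    "'i set \<Rightarrow> ('i \<Rightarrow> 'i \<Rightarrow> bool) \<Rightarrow> ('i \<Rightarrow> ('a, 'm) monoid_scheme) \<Rightarrow> ('i \<Rightarrow> 'i \<Rightarrow> 'a \<Rightarrow> 'a) \<Rightarrow>
     'i \<Rightarrow> 'a \<Rightarrow> ('i \<times> 'a) set" where
  "direct_limit_map I below A f i x = direct_limit_rel I below A f `` {(i, x)}"

text \<open>In the multiplication and the unit below, the unions are taken over representatives; by
  compatibility of the transition maps all the classes in such a union coincide.\<close>

definition direct_limit ::
    "'i set \<Rightarrow> ('i \<Rightarrow> 'i \<Rightarrow> bool) \<Rightarrow> ('i \<Rightarrow> ('a, 'm) monoid_scheme) \<Rightarrow> ('i \<Rightarrow> 'i \<Rightarrow> 'a \<Rightarrow> 'a) \<Rightarrow>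
     ('i \<times> 'a) set monoid" where
  "direct_limit I below A f =
     \<lparr>carrier = (SIGMA i:I. carrier (A i)) // direct_limit_rel I below A f,
      monoid.mult = (\<lambda>P Q. \<Union> {direct_limit_map I below A f k (f i k x \<otimes>\<^bsub>A k\<^esub> f j k y) | i x j y k.
         (i, x) \<in> P \<and> (j, y) \<in> Q \<and> k \<in> I \<and> below i k \<and> below j k}),
      monoid.one = (\<Union>i\<in>I. direct_limit_map I below A f i \<one>\<^bsub>A i\<^esub>)\<rparr>"

text \<open>Inverse limits: \<open>f i j\<close>, for \<open>i\<close> below \<open>j\<close>, is the transition map from \<open>A j\<close> to \<open>A i\<close>. The
  canonical map to \<open>A i\<close> is evaluation at \<open>i\<close>.\<close>

definition inverse_limit ::
    "'i set \<Rightarrow> ('i \<Rightarrow> 'i \<Rightarrow> bool) \<Rightarrow> ('i \<Rightarrow> 'a top_group) \<Rightarrow> ('i \<Rightarrow> 'i \<Rightarrow> 'a \<Rightarrow> 'a) \<Rightarrow>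
     ('i \<Rightarrow> 'a) top_group" where
  "inverse_limit I below A f =
     (let L = {k \<in> carrier (product_group I A). \<forall>i\<in>I. \<forall>j\<in>I. below i j \<longrightarrow> f i j (k j) = k i}
      in \<lparr>carrier = L,
          monoid.mult = (\<otimes>\<^bsub>product_group I A\<^esub>),
          monoid.one = \<one>\<^bsub>product_group I A\<^esub>,
          tp = subtopology (product_topology (\<lambda>i. tp (A i)) I) L\<rparr>)"


section \<open>Ore localization of a left action\<close>

definition kernel_union ::
    "('s, 'm) monoid_scheme \<Rightarrow> ('x, 'p) monoid_scheme \<Rightarrow> ('s \<Rightarrow> 'x \<Rightarrow> 'x) \<Rightarrow> 'x set" where
  "kernel_union S X lam = (\<Union>s\<in>carrier S. kernel X X (lam s))"

definition reduced_group ::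
    "('s, 'm) monoid_scheme \<Rightarrow> ('x, 'p) monoid_scheme \<Rightarrow> ('s \<Rightarrow> 'x \<Rightarrow> 'x) \<Rightarrow> 'x set monoid" where
  "reduced_group S X lam = X Mod kernel_union S X lam"

text \<open>The map induced on cosets: the coset of \<open>x\<close> goes to the coset of \<open>lam s x\<close>, which is the
  product of the kernel union with the image under \<open>lam s\<close> of the coset of \<open>x\<close>.\<close>

definition reduced_action ::
    "('s, 'm) monoid_scheme \<Rightarrow> ('x, 'p) monoid_scheme \<Rightarrow> ('s \<Rightarrow> 'x \<Rightarrow> 'x) \<Rightarrow>
     's \<Rightarrow> 'x set \<Rightarrow> 'x set" where
  "reduced_action S X lam s C = kernel_union S X lam <#>\<^bsub>X\<^esub> (lam s ` C)"

definition ore_localization ::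
    "('s, 'm) monoid_scheme \<Rightarrow> ('g, 'n) monoid_scheme \<Rightarrow> ('s \<Rightarrow> 'g) \<Rightarrow>
     ('x, 'p) monoid_scheme \<Rightarrow> ('s \<Rightarrow> 'x \<Rightarrow> 'x) \<Rightarrow> ('g \<times> 'x set) set monoid" where
  "ore_localization S G \<iota> X lam =
     direct_limit (carrier G) (fraction_le S G \<iota>) (\<lambda>g. reduced_group S X lam)
       (\<lambda>g1 g2. reduced_action S X lam (fraction_quotient S G \<iota> g1 g2))"

definition ore_localization_map ::
    "('s, 'm) monoid_scheme \<Rightarrow> ('g, 'n) monoid_scheme \<Rightarrow> ('s \<Rightarrow> 'g) \<Rightarrow>
     ('x, 'p) monoid_scheme \<Rightarrow> ('s \<Rightarrow> 'x \<Rightarrow> 'x) \<Rightarrow> 'g \<Rightarrow> 'x set \<Rightarrow> ('g \<times> 'x set) set" where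
  "ore_localization_map S G \<iota> X lam =
     direct_limit_map (carrier G) (fraction_le S G \<iota>) (\<lambda>g. reduced_group S X lam)
       (\<lambda>g1 g2. reduced_action S X lam (fraction_quotient S G \<iota> g1 g2))"

text \<open>The action of \<open>G\<close> on the localization moves the index of every representative; that this
  is the map sending \<open>\<epsilon> h x\<close> to \<open>\<epsilon> (g h) x\<close> is proved below.\<close>

definition localized_action ::
    "('g, 'n) monoid_scheme \<Rightarrow> 'g \<Rightarrow> ('g \<times> 'y) set \<Rightarrow> ('g \<times> 'y) set" where
  "localized_action G g P = (\<lambda>(h, x). (g \<otimes>\<^bsub>G\<^esub> h, x)) ` P"

lemma inv_mult_cancel:
  assumes "group G" "g \<in> carrier G" "h \<in> carrier G" "k \<in> carrier G"
  shows "inv\<^bsub>G\<^esub> (g \<otimes>\<^bsub>G\<^esub> k) \<otimes>\<^bsub>G\<^esub> (g \<otimes>\<^bsub>G\<^esub> h) = inv\<^bsub>G\<^esub> k \<otimes>\<^bsub>G\<^esub> h"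
proof -
  interpret group G by fact
  show ?thesis using assms(2-)
    by (metis inv_closed inv_mult_group inv_solve_left m_assoc m_closed)
qed

lemma fraction_le_translate:
  assumes "group G" "g \<in> carrier G" "h \<in> carrier G" "k \<in> carrier G"
  shows "fraction_le S G \<iota> (g \<otimes>\<^bsub>G\<^esub> h) (g \<otimes>\<^bsub>G\<^esub> k) = fraction_le S G \<iota> h k"
    and "fraction_quotient S G \<iota> (g \<otimes>\<^bsub>G\<^esub> h) (g \<otimes>\<^bsub>G\<^esub> k) = fraction_quotient S G \<iota> h k"
  using inv_mult_cancel[OF assms] by (simp_all add: fraction_le_def fraction_quotient_def)

lemma localized_action_ore_localization_map:
  assumes "group G" "g \<in> carrier G" "h \<in> carrier G"
  shows "localized_action G g (ore_localization_map S G \<iota> X lam h x) =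
         ore_localization_map S G \<iota> X lam (g \<otimes>\<^bsub>G\<^esub> h) x"
proof -
  interpret group G by fact
  let ?R = "direct_limit_rel (carrier G) (fraction_le S G \<iota>) (\<lambda>g. reduced_group S X lam)
       (\<lambda>g1 g2. reduced_action S X lam (fraction_quotient S G \<iota> g1 g2))"
  have shift: "((g \<otimes>\<^bsub>G\<^esub> a, u), (g \<otimes>\<^bsub>G\<^esub> b, v)) \<in> ?R"
    if R: "((a, u), (b, v)) \<in> ?R" and g: "g \<in> carrier G" for g a b u v
  proof -
    from R obtain k where k: "k \<in> carrier G" "fraction_le S G \<iota> a k" "fraction_le S G \<iota> b k"
        "reduced_action S X lam (fraction_quotient S G \<iota> a k) u =
         reduced_action S X lam (fraction_quotient S G \<iota> b k) v"
      and ab: "a \<in> carrier G" "b \<in> carrier G"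
        "u \<in> carrier (reduced_group S X lam)" "v \<in> carrier (reduced_group S X lam)"
      unfolding direct_limit_rel_def by blast
    show ?thesis
      unfolding direct_limit_rel_def using ab g k
      by (auto intro!: bexI[of _ "g \<otimes>\<^bsub>G\<^esub> k"] simp: fraction_le_translate assms(1))
  qed
  show ?thesis
  proof (intro equalityI subsetI)
    fix p assume "p \<in> localized_action G g (ore_localization_map S G \<iota> X lam h x)"
    then show "p \<in> ore_localization_map S G \<iota> X lam (g \<otimes>\<^bsub>G\<^esub> h) x"
      using shift[OF _ assms(2)]
      by (auto simp: localized_action_def ore_localization_map_def direct_limit_map_def)
  next
    fix p assume p: "p \<in> ore_localization_map S G \<iota> X lam (g \<otimes>\<^bsub>G\<^esub> h) x"
    obtain b v where bv: "p = (b, v)" by (cases p)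
    have R: "((g \<otimes>\<^bsub>G\<^esub> h, x), (b, v)) \<in> ?R"
      using p bv by (simp add: ore_localization_map_def direct_limit_map_def)
    then have b: "b \<in> carrier G" by (simp add: direct_limit_rel_def)
    have "((h, x), (inv\<^bsub>G\<^esub> g \<otimes>\<^bsub>G\<^esub> b, v)) \<in> ?R"
      using shift[OF R inv_closed[OF assms(2)]] assms(2,3) by (simp flip: m_assoc)
    moreover have "p = (g \<otimes>\<^bsub>G\<^esub> (inv\<^bsub>G\<^esub> g \<otimes>\<^bsub>G\<^esub> b), v)"
      using bv b assms(2) by (simp flip: m_assoc)
    ultimately show "p \<in> localized_action G g (ore_localization_map S G \<iota> X lam h x)"
      by (force simp: localized_action_def ore_localization_map_def direct_limit_map_def)
  qed
qed


section \<open>Ore colocalization of a right action\<close>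

definition core_group ::
    "('s, 'm) monoid_scheme \<Rightarrow> 'k top_group \<Rightarrow> ('s \<Rightarrow> 'k \<Rightarrow> 'k) \<Rightarrow> 'k top_group" where
  "core_group S K \<rho> =
     (let C = (\<Inter>t\<in>carrier S. \<rho> t ` carrier K)
      in K\<lparr>carrier := C, tp := subtopology (tp K) C\<rparr>)"

definition ore_colocalization ::
    "('s, 'm) monoid_scheme \<Rightarrow> ('g, 'n) monoid_scheme \<Rightarrow> ('s \<Rightarrow> 'g) \<Rightarrow>
     'k top_group \<Rightarrow> ('s \<Rightarrow> 'k \<Rightarrow> 'k) \<Rightarrow> ('g \<Rightarrow> 'k) top_group" where
  "ore_colocalization S G \<iota> K \<rho> =
     inverse_limit (carrier G) (fraction_le S G \<iota>) (\<lambda>g. core_group S K \<rho>)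
       (\<lambda>g1 g2. \<rho> (fraction_quotient S G \<iota> g1 g2))"

text \<open>The component of \<open>colocalized_action G g k\<close> at \<open>h\<close> is the component of \<open>k\<close> at \<open>g h\<close>.\<close>

definition colocalized_action ::
    "('g, 'n) monoid_scheme \<Rightarrow> 'g \<Rightarrow> ('g \<Rightarrow> 'k) \<Rightarrow> ('g \<Rightarrow> 'k)" where
  "colocalized_action G g k = (\<lambda>h\<in>carrier G. k (g \<otimes>\<^bsub>G\<^esub> h))"

end

theory Submission
  imports Defs
begin

text \<open>A character of \<open>X*\<close> is the same as a family, indexed by \<open>G\<close>, of characters of \<open>X\<close> that is
  compatible with the action. Compatibility forces every member into the core, so such families form
  the colocalization of the dual action, and both topologies are those of pointwise convergence.

  For a compact group \<open>K\<close>, the class of \<open>\<zeta>\<close> at the index \<open>g\<close> corresponds to the character \<open>\<zeta> (k g)\<close> of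
  \<open>k \<in> K*\<close>. Inside \<open>K^G\<close>, \<open>K*\<close> is the intersection of the closed sets of families that are compatible
  below a given index, so by compactness an open condition on \<open>K*\<close> already holds on one of these sets.
  Since uniformly close characters are equal, this gives injectivity. For surjectivity, a character of
  \<open>K*\<close> is extended to a continuous function on \<open>K^G\<close> (Tietze); its restriction to families generated
  by one component in \<open>K\<close> is almost multiplicative, hence close to a character of \<open>K\<close> (Hyers). Thus
  neither Pontryagin duality nor the extension of characters from closed subgroups is needed.\<close>

section \<open>Circle-valued homomorphisms\<close>

text \<open>The obstacle in the compact case is that evaluation at an index need not map
  \<open>K*\<close> onto \<open>K\<close>: an element of \<open>K\<close> may fail to be a component
  of a compatible family, so a statement about \<open>K*\<close> says nothing directly about
  characters of \<open>K\<close>. The set of families compatible at a single index \<open>h\<close>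
  is large enough: for every \<open>x\<close> in \<open>K\<close> it has a member with component
  \<open>x\<close> at \<open>h\<close>. The price is that only open conditions pass to it, so
  equalities are first weakened to inequalities. The constants share one budget: homomorphisms into
  the circle at distance below \<open>1\<close> are equal, and \<open>1 = 3/5 + 2/5\<close> is split
  between the passage from an almost multiplicative function to a character and the passage from a
  compatible family to the one generated by a single component.

  On the side of \<open>X*\<close>, the quotient by the kernel union and the direct limit are
  treated together. Both identify elements that become equal under the action of \<open>S\<close>,
  so elements of \<open>X*\<close> are represented by elements of \<open>X\<close> itself and cosets
  soon disappear.\<close>

lemma carrier_circle [simp]: "carrier circle = sphere 0 1"
  and mult_circle [simp]: "(\<otimes>\<^bsub>circle\<^esub>) = (*)"
  and one_circle [simp]: "\<one>\<^bsub>circle\<^esub> = 1"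
  and tp_circle [simp]: "tp circle = top_of_set (sphere 0 1)"
  by (simp_all add: circle_def)

text \<open>The norm condition occurs twice because nothing here ties the carrier of
  \<open>A\<close> to the underlying set of \<open>tp A\<close>; for topological groups the two
  coincide.\<close>

lemma in_characters_iff:
  "\<xi> \<in> characters A \<longleftrightarrow> \<xi> \<in> extensional (carrier A) \<and> (\<forall>x\<in>carrier A. norm (\<xi> x) = 1) \<and>
     (\<forall>x\<in>carrier A. \<forall>y\<in>carrier A. \<xi> (x \<otimes>\<^bsub>A\<^esub> y) = \<xi> x * \<xi> y) \<and>
     continuous_map (tp A) euclidean \<xi> \<and> (\<forall>x\<in>topspace (tp A). norm (\<xi> x) = 1)"
  by (auto simp: characters_def hom_def continuous_map_in_subtopology Pi_iff)

lemma carrier_dual [simp]: "carrier (dual A) = characters A"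
  and mult_dual [simp]: "(\<otimes>\<^bsub>dual A\<^esub>) = (\<lambda>\<xi> \<eta>. \<lambda>x\<in>carrier A. \<xi> x * \<eta> x)"
  and one_dual [simp]: "\<one>\<^bsub>dual A\<^esub> = (\<lambda>x\<in>carrier A. 1)"
  and tp_dual: "tp (dual A) = topology_generated_by
    {{\<xi> \<in> characters A. \<xi> ` C \<subseteq> U} | C U. compactin (tp A) C \<and> openin (tp circle) U}"
  by (simp_all add: dual_def)

text \<open>Exponent \<open>0\<close> is excluded because membership in \<open>hom\<close> does not
  include preservation of the unit.\<close>

lemma hom_circle_nat_pow:
  fixes n :: nat
  assumes "monoid A" "\<xi> \<in> hom A circle" "x \<in> carrier A" "0 < n"
  shows "\<xi> (x [^]\<^bsub>A\<^esub> n) = \<xi> x ^ n"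
proof -
  interpret monoid A by fact
  show ?thesis using assms(4)
  proof (induction n rule: nat_induct_non_zero)
    case (Suc n)
    then show ?case using hom_mult[OF assms(2) nat_pow_closed[OF assms(3)] assms(3), of n] by simp
  qed (use assms in simp)
qed

text \<open>Squaring expands the distance to \<open>1\<close> by a factor of at least \<open>3/2\<close> on the right half of
  the circle, so the circle has no small subgroups.\<close>

lemma powers_near_one_imp_one:
  fixes z :: complex
  assumes z: "norm z = 1" and near: "\<And>n. 0 < n \<Longrightarrow> norm (z ^ n - 1) < 1"
  shows "z = 1"
proof -
  \<comment> \<open>On the unit circle, \<open>norm (w - 1) < 1\<close> says exactly that
    \<open>Re w > 1/2\<close>.\<close>
  have half: "3/2 \<le> norm (w + 1)" if "norm w = 1" "norm (w - 1) < 1" for w :: complex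
  proof -
    have "(norm (w - 1))\<^sup>2 < 1"
      using that(2) by (simp add: power_less_one_iff)
    moreover have "(Re w)\<^sup>2 + (Im w)\<^sup>2 = 1"
      using that(1) by (metis cmod_power2 power_one)
    moreover have "(norm (w - 1))\<^sup>2 = (Re w)\<^sup>2 + (Im w)\<^sup>2 + 1 - 2 * Re w"
      unfolding cmod_power2 by (simp add: power2_eq_square algebra_simps)
    ultimately have "1/2 < Re w" by linarith
    then show ?thesis
      using complex_Re_le_cmod[of "w + 1"] by simp
  qed
  have grow: "(3/2)^n * norm (z - 1) \<le> norm (z ^ (2^n) - 1)" for n
  proof (induction n)
    case (Suc n)
    have p: "norm (z ^ (2^n)) = 1" "norm (z ^ (2^n) - 1) < 1"
      using z near[of "2^n"] by (simp_all add: norm_power)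
    have "z ^ (2^Suc n) = (z ^ (2^n))\<^sup>2"
      by (simp only: power_Suc2 power_mult)
    then have "z ^ (2^Suc n) - 1 = (z ^ (2^n) - 1) * (z ^ (2^n) + 1)"
      by (simp only:) (simp add: algebra_simps power2_eq_square)
    then have "norm (z ^ (2^Suc n) - 1) = norm (z ^ (2^n) - 1) * norm (z ^ (2^n) + 1)"
      by (simp add: norm_mult)
    moreover have "norm (z ^ (2^n) - 1) * (3/2) \<le> norm (z ^ (2^n) - 1) * norm (z ^ (2^n) + 1)"
      using half[OF p] by (intro mult_left_mono) auto
    ultimately show ?case using Suc by simp
  qed simp
  show ?thesis
  proof (rule ccontr)
    assume "z \<noteq> 1"
    then obtain n where "1 / norm (z - 1) < (3/2) ^ n"
      using real_arch_pow[of "3/2"] by auto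
    then have "1 < (3/2)^n * norm (z - 1)"
      using \<open>z \<noteq> 1\<close> by (simp add: field_simps)
    moreover have "norm (z ^ (2^n) - 1) < 1"
      using near[of "2^n"] by simp
    ultimately show False using grow[of n] by linarith
  qed
qed

text \<open>The closeness hypothesis is applied to all positive powers of \<open>x\<close>: it keeps
  every power of \<open>\<xi> x / \<eta> x\<close> within distance \<open>1\<close> of
  \<open>1\<close>, which forces this quotient to be \<open>1\<close>.\<close>

lemma close_hom_circle_eq:
  assumes "monoid A" "\<xi> \<in> hom A circle" "\<eta> \<in> hom A circle" "x \<in> carrier A"
    and near: "\<And>y. y \<in> carrier A \<Longrightarrow> norm (\<xi> y - \<eta> y) < 1"
  shows "\<xi> x = \<eta> x"
proof -
  interpret monoid A by fact
  have n1: "norm (\<xi> x) = 1" "norm (\<eta> x) = 1" using assms(2-4) by (auto simp: hom_def Pi_iff)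
  then have nz: "\<eta> x \<noteq> 0" by auto
  have "\<xi> x / \<eta> x = 1"
  proof (rule powers_near_one_imp_one)
    fix n :: nat assume n: "0 < n"
    have "norm ((\<xi> x / \<eta> x) ^ n - 1) = norm ((\<xi> x ^ n - \<eta> x ^ n) / \<eta> x ^ n)"
      using nz by (simp add: power_divide diff_divide_distrib)
    also have "\<dots> = norm (\<xi> x ^ n - \<eta> x ^ n)"
      using n1 by (simp add: norm_divide norm_power)
    also have "\<dots> < 1"
      using near[OF nat_pow_closed[OF assms(4), of n]] assms(1-4) n
      by (simp add: hom_circle_nat_pow del: nat_pow_Suc power_Suc)
    finally show "norm ((\<xi> x / \<eta> x) ^ n - 1) < 1" .
  qed (use n1 in \<open>simp add: norm_divide\<close>)
  then show ?thesis using nz by simp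
qed

section \<open>Continuous maps from abstract spaces into Euclidean spaces, and approximate
  characters\<close>

lemma continuous_map_compose_euclidean:
  assumes "continuous_map X euclidean f" "f \<in> topspace X \<rightarrow> T" "continuous_on T h"
  shows "continuous_map X euclidean (\<lambda>x. h (f x))"
proof -
  have "continuous_map X (top_of_set T) f"
    using assms by (simp add: continuous_map_into_subtopology)
  moreover have "continuous_map (top_of_set T) euclidean h"
    using assms by simp
  ultimately have "continuous_map X euclidean (h \<circ> f)"
    by (rule continuous_map_compose)
  then show ?thesis by (simp add: o_def)
qed

lemma continuous_map_compose2_euclidean:
  assumes "continuous_map X euclidean f" "continuous_map X euclidean g"
    "\<And>x. x \<in> topspace X \<Longrightarrow> (f x, g x) \<in> T" "continuous_on T h"
  shows "continuous_map X euclidean (\<lambda>x. h (f x, g x))"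
proof (rule continuous_map_compose_euclidean[where f = "\<lambda>x. (f x, g x)" and T = T])
  show "continuous_map X euclidean (\<lambda>x. (f x, g x))"
    using continuous_map_pairedI[OF assms(1,2)] by (simp add: euclidean_product_topology)
qed (use assms in auto)

lemma continuous_map_times:
  fixes f g :: "'a \<Rightarrow> 'b::real_normed_algebra"
  assumes "continuous_map X euclidean f" "continuous_map X euclidean g"
  shows "continuous_map X euclidean (\<lambda>x. f x * g x)"
  using continuous_map_compose2_euclidean[OF assms, of UNIV "\<lambda>(u, v). u * v"]
  by (simp add: case_prod_unfold continuous_intros)

text \<open>Hyers' argument: on an Abelian group the cocycle \<open>\<delta>\<close> measuring the failure of \<open>F\<close> to be
  multiplicative is the coboundary of \<open>-\<phi>\<close>, where \<open>\<phi> x\<close> is the sum of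
  \<open>2^-(n+1) \<delta> (x^(2^n), x^(2^n))\<close>; no invariant mean is needed.\<close>

theorem approximate_character:
  assumes A: "topological_ab_group A" and F: "continuous_map (tp A) euclidean F"
    and mult: "\<And>x y. x \<in> carrier A \<Longrightarrow> y \<in> carrier A \<Longrightarrow>
      norm (F (x \<otimes>\<^bsub>A\<^esub> y) - F x * F y) < norm (F x * F y) / 16"
    and bound: "\<And>x. x \<in> carrier A \<Longrightarrow> norm (F x) < 2"
  obtains \<zeta> where "\<zeta> \<in> characters A" "\<And>x. x \<in> carrier A \<Longrightarrow> norm (\<zeta> x - F x) < 3/5"
proof -
  interpret comm_group A using A by (simp add: topological_ab_group_def)
  have top: "topspace (tp A) = carrier A" using A by (simp add: topological_ab_group_def)
  \<comment> \<open>The error bound is strict, so its right-hand side, taken at the pair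
    \<open>x\<close>, \<open>x\<close>, is positive.\<close>
  have nz: "F x \<noteq> 0" if "x \<in> carrier A" for x
    using mult[OF that that] by auto
  define w where "w = (\<lambda>x y. F (x \<otimes>\<^bsub>A\<^esub> y) / (F x * F y))"
  define \<delta> where "\<delta> = (\<lambda>x y. Ln (w x y))"
  have w1: "norm (w x y - 1) < 1/16" if "x \<in> carrier A" "y \<in> carrier A" for x y
  proof -
    have "w x y - 1 = (F (x \<otimes>\<^bsub>A\<^esub> y) - F x * F y) / (F x * F y)"
      using nz that by (simp add: w_def diff_divide_distrib)
    moreover have "F x * F y \<noteq> 0"
      using nz that by simp
    ultimately show ?thesis
      using mult[OF that] by (simp only: norm_divide) (simp add: divide_simps)
  qed
  have w0: "w x y \<noteq> 0" if "x \<in> carrier A" "y \<in> carrier A" for x y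
    using nz that by (simp add: w_def)
  have exp\<delta>: "exp (\<delta> x y) = w x y" if "x \<in> carrier A" "y \<in> carrier A" for x y
    using w0[OF that] by (simp add: \<delta>_def)
  \<comment> \<open>Near \<open>0\<close> the norm of \<open>Ln (1 + z)\<close> is at most twice
    that of \<open>z\<close>, which turns the \<open>1/16\<close> of the hypothesis into
    \<open>1/8\<close>.\<close>
  have \<delta>8: "norm (\<delta> x y) \<le> 1/8" if "x \<in> carrier A" "y \<in> carrier A" for x y
    using norm_Ln_le[of "w x y - 1"] w1[OF that] by (simp add: \<delta>_def)
  define D where "D = (\<lambda>x. \<delta> x x)"
  \<comment> \<open>Both sides have the same exponential, because squaring is a homomorphism on an
    Abelian group. Both have norm at most \<open>3/8\<close>, so they cannot differ by a nonzero
    multiple of \<open>2 pi i\<close>.\<close>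
  have D_add: "D (x \<otimes>\<^bsub>A\<^esub> y) - D x - D y = \<delta> (x \<otimes>\<^bsub>A\<^esub> x) (y \<otimes>\<^bsub>A\<^esub> y) - 2 * \<delta> x y"
    if xy: "x \<in> carrier A" "y \<in> carrier A" for x y
  proof (rule exp_complex_eqI)
    let ?l = "D (x \<otimes>\<^bsub>A\<^esub> y) - D x - D y" and ?r = "\<delta> (x \<otimes>\<^bsub>A\<^esub> x) (y \<otimes>\<^bsub>A\<^esub> y) - 2 * \<delta> x y"
    have "norm ?l \<le> 1/8 + 1/8 + 1/8"
      unfolding D_def using xy by (intro norm_triangle_le_diff add_mono \<delta>8) auto
    moreover have "norm ?r \<le> 1/8 + 2 * (1/8)"
      using xy \<delta>8[OF xy] by (intro norm_triangle_le_diff add_mono \<delta>8) (auto simp: norm_mult)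
    ultimately have "norm (?l - ?r) \<le> 3/4"
      using norm_triangle_ineq4[of ?l ?r] by simp
    then have "\<bar>Im ?l - Im ?r\<bar> \<le> 3/4"
      using abs_Im_le_cmod[of "?l - ?r"] by simp
    then show "\<bar>Im ?l - Im ?r\<bar> < 2 * pi"
      using pi_gt3 by linarith
    have sq: "x \<otimes>\<^bsub>A\<^esub> y \<otimes>\<^bsub>A\<^esub> (x \<otimes>\<^bsub>A\<^esub> y) = x \<otimes>\<^bsub>A\<^esub> x \<otimes>\<^bsub>A\<^esub> (y \<otimes>\<^bsub>A\<^esub> y)"
      using xy by (simp add: m_ac)
    have e2: "exp (2 * \<delta> x y) = w x y * w x y"
      unfolding mult_2 exp_add exp\<delta>[OF xy] by (rule refl)
    have "exp ?l = w (x \<otimes>\<^bsub>A\<^esub> y) (x \<otimes>\<^bsub>A\<^esub> y) / w x x / w y y"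
      using xy by (simp add: exp_diff D_def exp\<delta>)
    moreover have "exp ?r = w (x \<otimes>\<^bsub>A\<^esub> x) (y \<otimes>\<^bsub>A\<^esub> y) / (w x y * w x y)"
      using xy by (simp add: exp_diff e2 exp\<delta>)
    moreover have "w (x \<otimes>\<^bsub>A\<^esub> y) (x \<otimes>\<^bsub>A\<^esub> y) / w x x / w y y =
        w (x \<otimes>\<^bsub>A\<^esub> x) (y \<otimes>\<^bsub>A\<^esub> y) / (w x y * w x y)"
      using xy nz by (simp add: w_def sq divide_simps)
    ultimately show "exp ?l = exp ?r" by simp
  qed
  define q where "q = (\<lambda>n x. x [^]\<^bsub>A\<^esub> ((2::nat) ^ n))"
  have q_closed: "q n x \<in> carrier A" if "x \<in> carrier A" for n x
    using that by (simp add: q_def)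
  have q_Suc: "q (Suc n) x = q n x \<otimes>\<^bsub>A\<^esub> q n x" if "x \<in> carrier A" for n x
    using that by (simp add: q_def nat_pow_mult mult_2)
  have q_mult: "q n (x \<otimes>\<^bsub>A\<^esub> y) = q n x \<otimes>\<^bsub>A\<^esub> q n y" if "x \<in> carrier A" "y \<in> carrier A" for n x y
    using that by (simp add: q_def nat_pow_distrib)
  \<comment> \<open>For \<open>F x * exp (\<phi> x)\<close> to respect squares,
    \<open>D x = 2 * \<phi> x - \<phi> (x^2)\<close> suffices, that is,
    \<open>\<phi> x = (D x + \<phi> (x^2)) / 2\<close>. Iterating this equation gives the
    series.\<close>
  define \<phi> where "\<phi> = (\<lambda>x. \<Sum>n. (1/2)^Suc n * D (q n x))"
  have term_bound: "norm ((1/2)^Suc n * D (q n x)) \<le> (1/2)^Suc n * (1/8)" if "x \<in> carrier A" for n x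
    using \<delta>8[OF q_closed[OF that] q_closed[OF that], of n n]
    by (simp add: norm_mult norm_power D_def norm_divide power_one_over divide_simps)
  have geo: "(\<lambda>n. (1/2)^Suc n * (1/8)) sums (1/8 :: real)"
    using sums_mult2[OF power_half_series, of "1/8"] by simp
  have summ: "summable (\<lambda>n. (1/2)^Suc n * D (q n x))" if "x \<in> carrier A" for x
    by (rule summable_comparison_test'[OF sums_summable[OF geo] term_bound[OF that]])
  have \<phi>8: "norm (\<phi> x) \<le> 1/8" if "x \<in> carrier A" for x
  proof -
    have "norm (\<phi> x) \<le> (\<Sum>n. (1/2)^Suc n * (1/8))"
      unfolding \<phi>_def by (rule norm_suminf_le[OF term_bound[OF that] sums_summable[OF geo]])
    then show ?thesis using sums_unique[OF geo] by simp
  qed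
  have \<phi>_add: "\<phi> (x \<otimes>\<^bsub>A\<^esub> y) - \<phi> x - \<phi> y = - \<delta> x y" if xy: "x \<in> carrier A" "y \<in> carrier A" for x y
  proof -
    \<comment> \<open>By \<open>D_add\<close> at \<open>q n x\<close> and \<open>q n y\<close>, the
      \<open>n\<close>-th term of the series for the left-hand side is
      \<open>a (Suc n) - a n\<close>; the sum telescopes to \<open>- a 0\<close>.\<close>
    define a where "a = (\<lambda>n. (1/2)^n * \<delta> (q n x) (q n y))"
    have "(\<lambda>n. (1/2)^n * (1/8::real)) \<longlonglongrightarrow> 0"
      by (intro tendsto_mult_left_zero LIMSEQ_realpow_zero) auto
    then have "a \<longlonglongrightarrow> 0"
    proof (rule Lim_null_comparison[rotated], intro always_eventually allI)
      fix n show "norm (a n) \<le> (1/2)^n * (1/8)"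
        using \<delta>8[OF q_closed[OF xy(1)] q_closed[OF xy(2)], of n n]
        by (simp add: a_def norm_mult norm_power norm_divide power_one_over divide_simps)
    qed
    then have "(\<lambda>n. a (Suc n) - a n) sums (0 - a 0)"
      by (rule telescope_sums)
    moreover have "a (Suc n) - a n =
        (1/2)^Suc n * D (q n (x \<otimes>\<^bsub>A\<^esub> y)) - (1/2)^Suc n * D (q n x) - (1/2)^Suc n * D (q n y)" for n
    proof -
      have "a (Suc n) - a n = (1/2)^Suc n * (\<delta> (q n x \<otimes>\<^bsub>A\<^esub> q n x) (q n y \<otimes>\<^bsub>A\<^esub> q n y) - 2 * \<delta> (q n x) (q n y))"
        using xy by (simp add: a_def q_Suc algebra_simps)
      also have "\<dots> = (1/2)^Suc n * (D (q n x \<otimes>\<^bsub>A\<^esub> q n y) - D (q n x) - D (q n y))"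
        using D_add[OF q_closed[OF xy(1)] q_closed[OF xy(2)], of n n] by simp
      finally show ?thesis using xy by (simp only: q_mult right_diff_distrib)
    qed
    moreover have "(\<lambda>n. (1/2)^Suc n * D (q n (x \<otimes>\<^bsub>A\<^esub> y)) - (1/2)^Suc n * D (q n x) - (1/2)^Suc n * D (q n y))
        sums (\<phi> (x \<otimes>\<^bsub>A\<^esub> y) - \<phi> x - \<phi> y)"
      unfolding \<phi>_def using xy by (intro sums_diff summable_sums summ) auto
    ultimately have "0 - a 0 = \<phi> (x \<otimes>\<^bsub>A\<^esub> y) - \<phi> x - \<phi> y"
      using sums_unique2 by fastforce
    then show ?thesis using xy by (simp add: a_def q_def)
  qed
  define \<zeta> where "\<zeta> = (\<lambda>x\<in>carrier A. F x * exp (\<phi> x))"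
  have \<zeta>_mult: "\<zeta> (x \<otimes>\<^bsub>A\<^esub> y) = \<zeta> x * \<zeta> y" if xy: "x \<in> carrier A" "y \<in> carrier A" for x y
  proof -
    have "\<phi> (x \<otimes>\<^bsub>A\<^esub> y) = \<phi> x + \<phi> y - \<delta> x y" using \<phi>_add[OF xy] by (simp add: algebra_simps)
    then have "exp (\<phi> (x \<otimes>\<^bsub>A\<^esub> y)) * w x y = exp (\<phi> x) * exp (\<phi> y)"
      using xy w0[OF xy] by (simp add: exp_diff exp_add exp\<delta>)
    then show ?thesis using xy nz by (simp add: \<zeta>_def w_def field_simps)
  qed
  \<comment> \<open>So far \<open>\<zeta>\<close> is multiplicative with values in the nonzero
    complex numbers. Being bounded, it has no value outside the closed unit disc, since the powers
    of such a value would be unbounded; passing to inverses excludes the open disc.\<close>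
  have \<zeta>_bound: "norm (\<zeta> x) \<le> 2 * exp (1/8)" if "x \<in> carrier A" for x
  proof -
    have "norm (exp (\<phi> x)) \<le> exp (1/8)"
      using norm_exp[of "\<phi> x"] \<phi>8[OF that] by (meson exp_le_cancel_iff order_trans)
    then show ?thesis
      using bound[OF that] that by (auto simp: \<zeta>_def norm_mult intro!: mult_mono)
  qed
  have \<zeta>_pow: "\<zeta> (x [^]\<^bsub>A\<^esub> Suc n) = \<zeta> x ^ Suc n" if "x \<in> carrier A" for x n
  proof (induction n)
    case (Suc n)
    then show ?case
      using \<zeta>_mult[of "x [^]\<^bsub>A\<^esub> Suc n" x] that by simp
  qed (use that in simp)
  have \<zeta>_le: "norm (\<zeta> x) \<le> 1" if "x \<in> carrier A" for x
  proof (rule ccontr)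
    assume "\<not> norm (\<zeta> x) \<le> 1"
    then obtain n where n: "2 * exp (1/8) < norm (\<zeta> x) ^ n"
      using real_arch_pow[of "norm (\<zeta> x)"] by auto
    also have "\<dots> \<le> norm (\<zeta> x) ^ Suc n"
      using \<open>\<not> norm (\<zeta> x) \<le> 1\<close> by (intro power_increasing) auto
    finally show False
      using \<zeta>_bound[of "x [^]\<^bsub>A\<^esub> Suc n"] that \<zeta>_pow[OF that, of n]
      by (simp add: norm_power norm_mult del: nat_pow_Suc power_Suc)
  qed
  have \<zeta>1: "\<zeta> \<one>\<^bsub>A\<^esub> = 1"
    using \<zeta>_mult[of "\<one>\<^bsub>A\<^esub>" "\<one>\<^bsub>A\<^esub>"] nz[of "\<one>\<^bsub>A\<^esub>"] by (simp add: \<zeta>_def)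
  have \<zeta>_norm: "norm (\<zeta> x) = 1" if "x \<in> carrier A" for x
  proof -
    have "norm (\<zeta> x) * norm (\<zeta> (inv\<^bsub>A\<^esub> x)) = 1"
      using \<zeta>_mult[of x "inv\<^bsub>A\<^esub> x"] \<zeta>1 that by (simp flip: norm_mult)
    moreover have "norm (\<zeta> x) * norm (\<zeta> (inv\<^bsub>A\<^esub> x)) \<le> norm (\<zeta> x)"
      using \<zeta>_le[of "inv\<^bsub>A\<^esub> x"] that by (simp add: mult_left_le)
    ultimately show ?thesis using \<zeta>_le[OF that] by linarith
  qed
  have w_cont: "continuous_map (tp A) euclidean D"
  proof -
    have sq: "continuous_map (tp A) (tp A) (\<lambda>x. x \<otimes>\<^bsub>A\<^esub> x)"
      using continuous_map_compose[of "tp A" "prod_topology (tp A) (tp A)" "\<lambda>x. (x, x)" "tp A" "\<lambda>(x, y). x \<otimes>\<^bsub>A\<^esub> y"] A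
      by (simp add: topological_ab_group_def o_def continuous_map_paired)
    have F2: "continuous_map (tp A) euclidean (\<lambda>x. F (x \<otimes>\<^bsub>A\<^esub> x))"
      using continuous_map_compose[OF sq F] by (simp add: o_def)
    have FF: "continuous_map (tp A) euclidean (\<lambda>x. F x * F x)"
      by (intro continuous_map_times F)
    have W: "continuous_map (tp A) euclidean (\<lambda>x. w x x)"
      using continuous_map_compose2_euclidean[OF F2 FF, of "UNIV \<times> (- {0})" "\<lambda>(u, v). u / v"] nz top
      by (simp add: w_def case_prod_unfold continuous_intros)
    have "continuous_on (ball 1 1) Ln"
    proof (rule continuous_on_Ln)
      fix z :: complex assume "z \<in> ball 1 1"
      then have "\<bar>Re (1 - z)\<bar> < 1"
        using abs_Re_le_cmod[of "1 - z"] by (simp add: dist_norm)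
      then have "Re z > 0" by simp
      then show "z \<notin> \<real>\<^sub>\<le>\<^sub>0" by (auto simp: complex_nonpos_Reals_iff)
    qed
    moreover have "w x x \<in> ball 1 1" if "x \<in> carrier A" for x
      using w1[OF that that] by (simp add: dist_norm norm_minus_commute)
    ultimately show ?thesis
      unfolding D_def \<delta>_def using continuous_map_compose_euclidean[OF W, of "ball 1 1" Ln] top by auto
  qed
  have q_cont: "continuous_map (tp A) (tp A) (q n)" for n
  proof (induction n)
    case 0
    have "continuous_map (tp A) (tp A) (\<lambda>x. x)" by simp
    then show ?case by (rule continuous_map_eq) (simp add: q_def top)
  next
    case (Suc n)
    have "continuous_map (tp A) (tp A) ((\<lambda>(x, y). x \<otimes>\<^bsub>A\<^esub> y) \<circ> (\<lambda>x. (q n x, q n x)))"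
      using A Suc by (intro continuous_map_compose) (auto simp: topological_ab_group_def continuous_map_paired)
    then show ?case by (rule continuous_map_eq) (simp add: q_Suc top)
  qed
  have \<phi>_cont: "continuous_map (tp A) euclidean \<phi>"
  proof -
    have "continuous_map (tp A) Met_TC.mtopology \<phi>"
    proof (rule Met_TC.continuous_map_uniform_limit[where F = sequentially and f = "\<lambda>N x. \<Sum>n<N. (1/2)^Suc n * D (q n x)"])
      show "\<forall>\<^sub>F N in sequentially. continuous_map (tp A) Met_TC.mtopology (\<lambda>x. \<Sum>n<N. (1/2)^Suc n * D (q n x))"
        unfolding mtopology_is_euclidean
        by (intro always_eventually allI continuous_map_sum continuous_map_times)
          (use continuous_map_compose[OF q_cont w_cont] in \<open>auto simp: o_def\<close>)
      fix e :: real assume "0 < e"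
      have "uniform_limit (carrier A) (\<lambda>N x. \<Sum>n<N. (1/2)^Suc n * D (q n x)) \<phi> sequentially"
        unfolding \<phi>_def by (rule Weierstrass_m_test[OF term_bound sums_summable[OF geo]])
      then show "\<forall>\<^sub>F N in sequentially. \<forall>x\<in>topspace (tp A). \<phi> x \<in> UNIV \<and> dist (\<Sum>n<N. (1/2)^Suc n * D (q n x)) (\<phi> x) < e"
        using \<open>0 < e\<close> by (simp add: uniform_limit_iff top)
    qed simp
    then show ?thesis by simp
  qed
  have "continuous_map (tp A) euclidean (\<lambda>x. F x * exp (\<phi> x))"
    using continuous_map_compose_euclidean[OF \<phi>_cont, of UNIV exp]
    by (intro continuous_map_times F) (simp add: continuous_on_exp)
  then have "continuous_map (tp A) euclidean \<zeta>"
    by (rule continuous_map_eq) (simp add: \<zeta>_def top)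
  then have "\<zeta> \<in> characters A"
    using \<zeta>_mult \<zeta>_norm top by (auto simp: in_characters_iff \<zeta>_def)
  moreover have "norm (\<zeta> x - F x) < 3/5" if "x \<in> carrier A" for x
  proof -
    \<comment> \<open>This is the source of \<open>3/5\<close>: \<open>F\<close> is bounded by
      \<open>2\<close>, and \<open>2 * 3/10 = 3/5\<close>.\<close>
    have "norm (exp (\<phi> x) - 1) \<le> 3/10"
    proof -
      have "norm (exp (\<phi> x) - 1) \<le> exp (norm (\<phi> x)) * norm (\<phi> x)"
        using Taylor_exp_field[of "\<phi> x" 0] by simp
      also have "\<dots> \<le> exp (1/8) * (1/8)"
        using \<phi>8[OF that] by (intro mult_mono) auto
      also have "\<dots> \<le> 3/10"
        using exp_bound[of "1/8 :: real"] by (simp add: power2_eq_square)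
      finally show ?thesis .
    qed
    then have "norm (F x) * norm (exp (\<phi> x) - 1) \<le> norm (F x) * (3/10)"
      by (rule mult_left_mono) simp
    moreover have "norm (\<zeta> x - F x) = norm (F x) * norm (exp (\<phi> x) - 1)"
      using that by (simp add: \<zeta>_def algebra_simps flip: norm_mult)
    ultimately show ?thesis
      using bound[OF that] by linarith
  qed
  ultimately show ?thesis using that by blast
qed


section \<open>Groups of left fractions\<close>

locale left_fractions = S?: monoid S + G: group G
  for S :: "('s, 'm) monoid_scheme" and G :: "('g, 'n) monoid_scheme" (structure)
    and \<iota> :: "'s \<Rightarrow> 'g" +
  assumes fractions: "left_fraction_group S G \<iota>"
begin

lemma \<iota>_closed [simp, intro]: "s \<in> carrier S \<Longrightarrow> \<iota> s \<in> carrier G"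
  using fractions by (auto simp: left_fraction_group_def hom_def)

lemma \<iota>_mult: "s \<in> carrier S \<Longrightarrow> t \<in> carrier S \<Longrightarrow> \<iota> (s \<otimes>\<^bsub>S\<^esub> t) = \<iota> s \<otimes>\<^bsub>G\<^esub> \<iota> t"
  using fractions by (auto simp: left_fraction_group_def hom_def)

lemma \<iota>_eq_iff [simp]: "s \<in> carrier S \<Longrightarrow> t \<in> carrier S \<Longrightarrow> \<iota> s = \<iota> t \<longleftrightarrow> s = t"
  using fractions by (auto simp: left_fraction_group_def inj_on_eq_iff)

lemma \<iota>_one [simp]: "\<iota> \<one>\<^bsub>S\<^esub> = \<one>\<^bsub>G\<^esub>"
  using \<iota>_mult[of "\<one>\<^bsub>S\<^esub>" "\<one>\<^bsub>S\<^esub>"] by (simp add: G.l_cancel_one')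

lemma mult_\<iota>_mult:
  "g \<in> carrier G \<Longrightarrow> s \<in> carrier S \<Longrightarrow> t \<in> carrier S \<Longrightarrow>
    g \<otimes>\<^bsub>G\<^esub> \<iota> s \<otimes>\<^bsub>G\<^esub> \<iota> t = g \<otimes>\<^bsub>G\<^esub> \<iota> (s \<otimes>\<^bsub>S\<^esub> t)"
  by (simp add: \<iota>_mult G.m_assoc)

text \<open>Orientation: multiplying on the right by elements of \<open>S\<close> moves down in the
  preorder, so upper bounds are found by dividing on the right.\<close>

lemma fraction_le_iff:
  assumes "g \<in> carrier G" "h \<in> carrier G"
  shows "fraction_le S G \<iota> g h \<longleftrightarrow> (\<exists>s\<in>carrier S. g = h \<otimes>\<^bsub>G\<^esub> \<iota> s)"
proof -
  have "inv\<^bsub>G\<^esub> h \<otimes>\<^bsub>G\<^esub> g = \<iota> s \<longleftrightarrow> g = h \<otimes>\<^bsub>G\<^esub> \<iota> s" if "s \<in> carrier S" for s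
    using that assms G.inv_solve_left'[of "\<iota> s" h g] by auto
  then show ?thesis
    by (auto simp: fraction_le_def image_iff)
qed

lemma fraction_quotient_mult [simp]:
  assumes "h \<in> carrier G" "s \<in> carrier S"
  shows "fraction_quotient S G \<iota> (h \<otimes>\<^bsub>G\<^esub> \<iota> s) h = s"
proof -
  have "inv\<^bsub>G\<^esub> h \<otimes>\<^bsub>G\<^esub> (h \<otimes>\<^bsub>G\<^esub> \<iota> s) = \<iota> s"
    using assms by (simp flip: G.m_assoc)
  then show ?thesis
    using fractions assms by (simp add: fraction_quotient_def left_fraction_group_def)
qed

lemma fractionE:
  assumes "g \<in> carrier G"
  obtains s t where "s \<in> carrier S" "t \<in> carrier S" "\<iota> s \<otimes>\<^bsub>G\<^esub> g = \<iota> t"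
proof -
  obtain s t where "s \<in> carrier S" "t \<in> carrier S" "g = inv\<^bsub>G\<^esub> (\<iota> s) \<otimes>\<^bsub>G\<^esub> \<iota> t"
    using assms fractions by (auto simp: left_fraction_group_def)
  then show ?thesis
    by (intro that[of s t]) (simp_all flip: G.m_assoc)
qed

text \<open>The left Ore condition, obtained by writing the element \<open>s t^-1\<close> of
  \<open>G\<close> as a left fraction \<open>u^-1 v\<close>.\<close>

lemma oreE:
  assumes "s \<in> carrier S" "t \<in> carrier S"
  obtains u v where "u \<in> carrier S" "v \<in> carrier S" "u \<otimes>\<^bsub>S\<^esub> s = v \<otimes>\<^bsub>S\<^esub> t"
proof -
  obtain u v where uv: "u \<in> carrier S" "v \<in> carrier S"
      "\<iota> u \<otimes>\<^bsub>G\<^esub> (\<iota> s \<otimes>\<^bsub>G\<^esub> inv\<^bsub>G\<^esub> (\<iota> t)) = \<iota> v"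
    using fractionE[of "\<iota> s \<otimes>\<^bsub>G\<^esub> inv\<^bsub>G\<^esub> (\<iota> t)"] assms by auto
  then have "\<iota> u \<otimes>\<^bsub>G\<^esub> \<iota> s \<otimes>\<^bsub>G\<^esub> inv\<^bsub>G\<^esub> (\<iota> t) = \<iota> v"
    using assms by (simp add: G.m_assoc)
  then have "\<iota> u \<otimes>\<^bsub>G\<^esub> \<iota> s = \<iota> v \<otimes>\<^bsub>G\<^esub> \<iota> t"
    using assms uv by (metis G.inv_solve_right G.m_closed \<iota>_closed)
  then have "\<iota> (u \<otimes>\<^bsub>S\<^esub> s) = \<iota> (v \<otimes>\<^bsub>S\<^esub> t)"
    using assms uv by (simp add: \<iota>_mult)
  then show ?thesis
    using that[of u v] uv assms by simp
qed

text \<open>Directedness of the preorder: if \<open>g^-1 h = s^-1 t\<close>, then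
  \<open>k = g s^-1\<close> lies above both \<open>g\<close> and \<open>h\<close>.\<close>

lemma upper_boundE:
  assumes "g \<in> carrier G" "h \<in> carrier G"
  obtains k s t where "k \<in> carrier G" "s \<in> carrier S" "t \<in> carrier S"
    "g = k \<otimes>\<^bsub>G\<^esub> \<iota> s" "h = k \<otimes>\<^bsub>G\<^esub> \<iota> t"
proof -
  obtain s t where st: "s \<in> carrier S" "t \<in> carrier S" "\<iota> s \<otimes>\<^bsub>G\<^esub> (inv\<^bsub>G\<^esub> g \<otimes>\<^bsub>G\<^esub> h) = \<iota> t"
    using fractionE[of "inv\<^bsub>G\<^esub> g \<otimes>\<^bsub>G\<^esub> h"] assms by auto
  show ?thesis
  proof
    show "g \<otimes>\<^bsub>G\<^esub> inv\<^bsub>G\<^esub> (\<iota> s) \<in> carrier G" "s \<in> carrier S" "t \<in> carrier S"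
      using assms st by auto
    show "g = g \<otimes>\<^bsub>G\<^esub> inv\<^bsub>G\<^esub> (\<iota> s) \<otimes>\<^bsub>G\<^esub> \<iota> s"
      using assms st by (simp add: G.m_assoc)
    have cancel: "inv\<^bsub>G\<^esub> a \<otimes>\<^bsub>G\<^esub> (a \<otimes>\<^bsub>G\<^esub> b) = b" "a \<otimes>\<^bsub>G\<^esub> (inv\<^bsub>G\<^esub> a \<otimes>\<^bsub>G\<^esub> b) = b"
      if "a \<in> carrier G" "b \<in> carrier G" for a b
      using that by (simp_all flip: G.m_assoc)
    show "h = g \<otimes>\<^bsub>G\<^esub> inv\<^bsub>G\<^esub> (\<iota> s) \<otimes>\<^bsub>G\<^esub> \<iota> t"
      using assms st(1,2) by (simp add: G.m_assoc cancel flip: st(3))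
  qed
qed

end


section \<open>The Ore localization\<close>

locale ore_left_action = left_fractions S G \<iota> + X: comm_group X
  for S :: "('s, 'm) monoid_scheme" and G :: "('g, 'n) monoid_scheme" and \<iota> :: "'s \<Rightarrow> 'g"
    and X :: "('x, 'p) monoid_scheme" +
  fixes lam :: "'s \<Rightarrow> 'x \<Rightarrow> 'x"
  assumes action: "left_action S X lam"
begin

lemma lam_closed [simp, intro]: "s \<in> carrier S \<Longrightarrow> x \<in> carrier X \<Longrightarrow> lam s x \<in> carrier X"
  using action by (auto simp: left_action_def hom_def)

lemma lam_mult [simp]:
  "s \<in> carrier S \<Longrightarrow> x \<in> carrier X \<Longrightarrow> y \<in> carrier X \<Longrightarrow> lam s (x \<otimes>\<^bsub>X\<^esub> y) = lam s x \<otimes>\<^bsub>X\<^esub> lam s y"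
  using action by (auto simp: left_action_def hom_def)

lemma lam_one [simp]: "s \<in> carrier S \<Longrightarrow> lam s \<one>\<^bsub>X\<^esub> = \<one>\<^bsub>X\<^esub>"
  using lam_mult[of s "\<one>\<^bsub>X\<^esub>" "\<one>\<^bsub>X\<^esub>"] by (simp add: X.l_cancel_one')

lemma lam_inv [simp]: "s \<in> carrier S \<Longrightarrow> x \<in> carrier X \<Longrightarrow> lam s (inv\<^bsub>X\<^esub> x) = inv\<^bsub>X\<^esub> (lam s x)"
  using lam_mult[of s "inv\<^bsub>X\<^esub> x" x] by (intro X.inv_equality[symmetric]) simp_all

lemma lam_S_one [simp]: "x \<in> carrier X \<Longrightarrow> lam \<one>\<^bsub>S\<^esub> x = x"
  using action by (auto simp: left_action_def)

lemma lam_S_mult: "s \<in> carrier S \<Longrightarrow> t \<in> carrier S \<Longrightarrow> x \<in> carrier X \<Longrightarrow>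
    lam (s \<otimes>\<^bsub>S\<^esub> t) x = lam s (lam t x)"
  using action by (auto simp: left_action_def)

definition N where "N = kernel_union S X lam"

lemma in_N_iff: "x \<in> N \<longleftrightarrow> x \<in> carrier X \<and> (\<exists>s\<in>carrier S. lam s x = \<one>\<^bsub>X\<^esub>)"
  by (auto simp: N_def kernel_union_def kernel_def)

text \<open>If \<open>t\<close> kills \<open>x\<close>, the Ore condition \<open>u s = v t\<close>
  yields an element \<open>u\<close> that kills \<open>lam s x\<close>.\<close>

lemma lam_N: "s \<in> carrier S \<Longrightarrow> x \<in> N \<Longrightarrow> lam s x \<in> N"
proof -
  assume s: "s \<in> carrier S" and "x \<in> N"
  then obtain t where t: "t \<in> carrier S" "lam t x = \<one>\<^bsub>X\<^esub>" and x: "x \<in> carrier X"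
    by (auto simp: in_N_iff)
  obtain u v where uv: "u \<in> carrier S" "v \<in> carrier S" "u \<otimes>\<^bsub>S\<^esub> s = v \<otimes>\<^bsub>S\<^esub> t"
    using oreE s t(1) .
  then have "lam u (lam s x) = \<one>\<^bsub>X\<^esub>"
    using s t x by (simp flip: lam_S_mult) (simp add: lam_S_mult)
  then show ?thesis using uv s x by (auto simp: in_N_iff)
qed

text \<open>Closure under products is the point: a common left multiple of an element killing
  \<open>x\<close> and an element killing \<open>y\<close> kills both.\<close>

lemma subgroup_N: "subgroup N X"
proof (rule X.subgroupI)
  fix x y assume "x \<in> N" "y \<in> N"
  then obtain s t where st: "s \<in> carrier S" "lam s x = \<one>\<^bsub>X\<^esub>" "t \<in> carrier S" "lam t y = \<one>\<^bsub>X\<^esub>"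
    and xy: "x \<in> carrier X" "y \<in> carrier X"
    by (auto simp: in_N_iff)
  obtain u v where uv: "u \<in> carrier S" "v \<in> carrier S" "u \<otimes>\<^bsub>S\<^esub> s = v \<otimes>\<^bsub>S\<^esub> t"
    using oreE st(1,3) .
  have "lam (u \<otimes>\<^bsub>S\<^esub> s) x = \<one>\<^bsub>X\<^esub>"
    using st xy uv(1,2) by (simp add: lam_S_mult)
  moreover have "lam (u \<otimes>\<^bsub>S\<^esub> s) y = \<one>\<^bsub>X\<^esub>"
    unfolding uv(3) using st xy uv(1,2) by (simp add: lam_S_mult)
  ultimately have "lam (u \<otimes>\<^bsub>S\<^esub> s) (x \<otimes>\<^bsub>X\<^esub> y) = \<one>\<^bsub>X\<^esub>"
    using st xy uv(1,2) by simp
  then show "x \<otimes>\<^bsub>X\<^esub> y \<in> N" using uv(1) st(1) xy by (auto simp: in_N_iff)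
next
  have "\<one>\<^bsub>X\<^esub> \<in> N" by (auto simp: in_N_iff)
  then show "N \<noteq> {}" by blast
qed (auto simp: in_N_iff)

sublocale N: normal N X
  using subgroup_N X.subgroup_imp_normal by blast

section \<open>Cosets and germs\<close>

definition coset where "coset x = N #>\<^bsub>X\<^esub> x"

lemma coset_eq_iff:
  assumes "x \<in> carrier X" "y \<in> carrier X"
  shows "coset x = coset y \<longleftrightarrow> (\<exists>s\<in>carrier S. lam s x = lam s y)"
proof -
  have "coset x = coset y \<longleftrightarrow> x \<in> coset y"
    unfolding coset_def using assms X.repr_independence[OF _ assms(2) subgroup_N]
      X.rcos_self[OF assms(1) subgroup_N] by auto
  also have "\<dots> \<longleftrightarrow> x \<otimes>\<^bsub>X\<^esub> inv\<^bsub>X\<^esub> y \<in> N"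
    unfolding coset_def by (rule subgroup.rcos_module[OF subgroup_N X.is_group assms(2,1)])
  also have "\<dots> \<longleftrightarrow> (\<exists>s\<in>carrier S. lam s x = lam s y)"
  proof -
    have "lam s (x \<otimes>\<^bsub>X\<^esub> inv\<^bsub>X\<^esub> y) = \<one>\<^bsub>X\<^esub> \<longleftrightarrow> lam s x = lam s y" if "s \<in> carrier S" for s
      using that assms X.inv_solve_right'[of "\<one>\<^bsub>X\<^esub>" "lam s x" "lam s y"] by simp
    then show ?thesis
      using assms by (simp add: in_N_iff)
  qed
  finally show ?thesis .
qed

lemma carrier_reduced: "carrier (reduced_group S X lam) = coset ` carrier X"
  by (auto simp: reduced_group_def FactGroup_def RCOSETS_def coset_def simp flip: N_def)

lemma mult_reduced: "x \<in> carrier X \<Longrightarrow> y \<in> carrier X \<Longrightarrow>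
    coset x \<otimes>\<^bsub>reduced_group S X lam\<^esub> coset y = coset (x \<otimes>\<^bsub>X\<^esub> y)"
  by (simp add: reduced_group_def FactGroup_def coset_def N.rcos_sum flip: N_def)

text \<open>The image of a coset under \<open>lam s\<close> may be only a part of a coset. It stays
  in a single one by \<open>lam_N\<close>, and the product with \<open>N\<close> fills that one
  up.\<close>

lemma reduced_action_coset:
  assumes "s \<in> carrier S" "x \<in> carrier X"
  shows "reduced_action S X lam s (coset x) = coset (lam s x)"
proof -
  have "reduced_action S X lam s (coset x) = (\<Union>m\<in>N. \<Union>n\<in>N. {m \<otimes>\<^bsub>X\<^esub> lam s (n \<otimes>\<^bsub>X\<^esub> x)})"
    by (auto simp: reduced_action_def set_mult_def coset_def r_coset_def simp flip: N_def)
  also have "\<dots> = (\<Union>m\<in>N. {m \<otimes>\<^bsub>X\<^esub> lam s x})"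
  proof (intro equalityI subsetI)
    fix z assume "z \<in> (\<Union>m\<in>N. \<Union>n\<in>N. {m \<otimes>\<^bsub>X\<^esub> lam s (n \<otimes>\<^bsub>X\<^esub> x)})"
    then obtain m n where mn: "m \<in> N" "n \<in> N" "z = m \<otimes>\<^bsub>X\<^esub> lam s (n \<otimes>\<^bsub>X\<^esub> x)" by blast
    then have "m \<in> carrier X" "n \<in> carrier X" by (auto simp: in_N_iff)
    then have "z = (m \<otimes>\<^bsub>X\<^esub> lam s n) \<otimes>\<^bsub>X\<^esub> lam s x"
      using mn assms by (simp add: X.m_assoc)
    then show "z \<in> (\<Union>m\<in>N. {m \<otimes>\<^bsub>X\<^esub> lam s x})"
      using mn lam_N[OF assms(1)] by auto
  next
    fix z assume "z \<in> (\<Union>m\<in>N. {m \<otimes>\<^bsub>X\<^esub> lam s x})"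
    then obtain m where "m \<in> N" "z = m \<otimes>\<^bsub>X\<^esub> lam s (\<one>\<^bsub>X\<^esub> \<otimes>\<^bsub>X\<^esub> x)"
      using assms by auto
    then show "z \<in> (\<Union>m\<in>N. \<Union>n\<in>N. {m \<otimes>\<^bsub>X\<^esub> lam s (n \<otimes>\<^bsub>X\<^esub> x)})"
      using N.one_closed by blast
  qed
  finally show ?thesis by (simp add: coset_def r_coset_def)
qed

definition germ_rel where
  "germ_rel = direct_limit_rel (carrier G) (fraction_le S G \<iota>) (\<lambda>g. reduced_group S X lam)
       (\<lambda>g1 g2. reduced_action S X lam (fraction_quotient S G \<iota> g1 g2))"

text \<open>The argument is an element of \<open>X\<close> rather than a coset, so that calculations
  with germs take place in \<open>X\<close>.\<close>

definition germ where "germ g x = ore_localization_map S G \<iota> X lam g (coset x)"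

lemma germ_eq_Image: "germ g x = germ_rel `` {(g, coset x)}"
  by (simp add: germ_def germ_rel_def ore_localization_map_def direct_limit_map_def)

text \<open>Equality at \<open>k\<close> in the limit is an equality of cosets, which holds in
  \<open>X\<close> only after a further \<open>lam u\<close>. Replacing \<open>k\<close> by the
  larger index \<open>k u^-1\<close> absorbs this \<open>u\<close>, and thus merges the quotient by
  the kernel union with the one that defines the limit.\<close>

lemma germ_rel_iff:
  assumes "g \<in> carrier G" "h \<in> carrier G" "x \<in> carrier X" "y \<in> carrier X"
  shows "((g, coset x), (h, coset y)) \<in> germ_rel \<longleftrightarrow>
    (\<exists>k\<in>carrier G. \<exists>s\<in>carrier S. \<exists>t\<in>carrier S.
       g = k \<otimes>\<^bsub>G\<^esub> \<iota> s \<and> h = k \<otimes>\<^bsub>G\<^esub> \<iota> t \<and> lam s x = lam t y)" (is "_ \<longleftrightarrow> ?rhs")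
proof
  assume "((g, coset x), (h, coset y)) \<in> germ_rel"
  then obtain k s t where k: "k \<in> carrier G" and s: "s \<in> carrier S" "g = k \<otimes>\<^bsub>G\<^esub> \<iota> s"
    and t: "t \<in> carrier S" "h = k \<otimes>\<^bsub>G\<^esub> \<iota> t" and eq: "coset (lam s x) = coset (lam t y)"
    using assms by (auto simp: germ_rel_def direct_limit_rel_def fraction_le_iff reduced_action_coset)
  from eq obtain u where u: "u \<in> carrier S" "lam u (lam s x) = lam u (lam t y)"
    using assms s t by (auto simp: coset_eq_iff)
  let ?k = "k \<otimes>\<^bsub>G\<^esub> inv\<^bsub>G\<^esub> (\<iota> u)"
  have "?k \<in> carrier G" using k u by simp
  moreover have "k = ?k \<otimes>\<^bsub>G\<^esub> \<iota> u" using k u by (simp add: G.m_assoc)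
  then have "g = ?k \<otimes>\<^bsub>G\<^esub> \<iota> (u \<otimes>\<^bsub>S\<^esub> s)" "h = ?k \<otimes>\<^bsub>G\<^esub> \<iota> (u \<otimes>\<^bsub>S\<^esub> t)"
    using k s t u by (metis G.inv_closed G.m_closed \<iota>_closed mult_\<iota>_mult)+
  moreover have "lam (u \<otimes>\<^bsub>S\<^esub> s) x = lam (u \<otimes>\<^bsub>S\<^esub> t) y"
    using u s t assms by (simp add: lam_S_mult)
  ultimately show ?rhs
    using u(1) s(1) t(1) S.m_closed by blast
next
  assume ?rhs
  then obtain k s t where "k \<in> carrier G" "s \<in> carrier S" "t \<in> carrier S"
    "g = k \<otimes>\<^bsub>G\<^esub> \<iota> s" "h = k \<otimes>\<^bsub>G\<^esub> \<iota> t" "lam s x = lam t y" by blast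
  then show "((g, coset x), (h, coset y)) \<in> germ_rel"
    using assms
    by (auto simp: germ_rel_def direct_limit_rel_def fraction_le_iff carrier_reduced reduced_action_coset
        intro!: bexI[of _ k])
qed

lemma germ_rel_carrier: "(p, q) \<in> germ_rel \<Longrightarrow> \<exists>g\<in>carrier G. \<exists>x\<in>carrier X. \<exists>h\<in>carrier G. \<exists>y\<in>carrier X.
    p = (g, coset x) \<and> q = (h, coset y)"
  by (force simp: germ_rel_def direct_limit_rel_def carrier_reduced)

text \<open>An index with two upper bounds \<open>k\<close> and \<open>k'\<close> is reached from an
  index \<open>j\<close> above both in two ways. Cancellation in \<open>G\<close> and injectivity of
  \<open>\<iota>\<close> show that the two elements of \<open>S\<close> involved coincide.
  Transitivity and the compatibility of multiplication with germs rest on this.\<close>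

lemma common_refinementE:
  assumes "k \<in> carrier G" "k' \<in> carrier G" "t \<in> carrier S" "t' \<in> carrier S"
    "k \<otimes>\<^bsub>G\<^esub> \<iota> t = k' \<otimes>\<^bsub>G\<^esub> \<iota> t'"
  obtains j a b where "j \<in> carrier G" "a \<in> carrier S" "b \<in> carrier S"
    "k = j \<otimes>\<^bsub>G\<^esub> \<iota> a" "k' = j \<otimes>\<^bsub>G\<^esub> \<iota> b" "a \<otimes>\<^bsub>S\<^esub> t = b \<otimes>\<^bsub>S\<^esub> t'"
proof -
  obtain j a b where j: "j \<in> carrier G" "a \<in> carrier S" "b \<in> carrier S"
    "k = j \<otimes>\<^bsub>G\<^esub> \<iota> a" "k' = j \<otimes>\<^bsub>G\<^esub> \<iota> b"
    using upper_boundE assms(1,2) .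
  then have "j \<otimes>\<^bsub>G\<^esub> \<iota> (a \<otimes>\<^bsub>S\<^esub> t) = j \<otimes>\<^bsub>G\<^esub> \<iota> (b \<otimes>\<^bsub>S\<^esub> t')"
    using assms by (simp add: mult_\<iota>_mult)
  then have "a \<otimes>\<^bsub>S\<^esub> t = b \<otimes>\<^bsub>S\<^esub> t'"
    using assms j(1-3) by simp
  then show ?thesis using that j by blast
qed

lemma equiv_germ_rel: "equiv (carrier G \<times> coset ` carrier X) germ_rel"
proof (rule equivI)
  show "germ_rel \<subseteq> (carrier G \<times> coset ` carrier X) \<times> (carrier G \<times> coset ` carrier X)"
    using germ_rel_carrier by fastforce
  show "refl_on (carrier G \<times> coset ` carrier X) germ_rel"
  proof (rule refl_onI)
    fix p assume "p \<in> carrier G \<times> coset ` carrier X"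
    then obtain g x where "p = (g, coset x)" "g \<in> carrier G" "x \<in> carrier X" by auto
    moreover from this have "g = g \<otimes>\<^bsub>G\<^esub> \<iota> \<one>\<^bsub>S\<^esub>" by simp
    ultimately show "(p, p) \<in> germ_rel" using germ_rel_iff S.one_closed by blast
  qed
  show "sym germ_rel"
  proof (rule symI)
    fix p q assume "(p, q) \<in> germ_rel"
    moreover from germ_rel_carrier[OF this] obtain g x h y where
      "p = (g, coset x)" "q = (h, coset y)" "g \<in> carrier G" "x \<in> carrier X" "h \<in> carrier G" "y \<in> carrier X"
      by blast
    ultimately show "(q, p) \<in> germ_rel" by (auto simp: germ_rel_iff) metis
  qed
  show "trans germ_rel"
  proof (rule transI)
    fix p q r assume pq: "(p, q) \<in> germ_rel" and qr: "(q, r) \<in> germ_rel"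
    obtain g x h y where p: "p = (g, coset x)" "g \<in> carrier G" "x \<in> carrier X"
      and q: "q = (h, coset y)" "h \<in> carrier G" "y \<in> carrier X"
      using germ_rel_carrier[OF pq] by blast
    obtain m z where r: "r = (m, coset z)" "m \<in> carrier G" "z \<in> carrier X"
      using germ_rel_carrier[OF qr] by blast
    obtain k s t where k: "k \<in> carrier G" "s \<in> carrier S" "t \<in> carrier S"
      "g = k \<otimes>\<^bsub>G\<^esub> \<iota> s" "h = k \<otimes>\<^bsub>G\<^esub> \<iota> t" "lam s x = lam t y"
      using pq p q by (auto simp: germ_rel_iff)
    obtain k' s' t' where k': "k' \<in> carrier G" "s' \<in> carrier S" "t' \<in> carrier S"
      "h = k' \<otimes>\<^bsub>G\<^esub> \<iota> s'" "m = k' \<otimes>\<^bsub>G\<^esub> \<iota> t'" "lam s' y = lam t' z"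
      using qr q r by (auto simp: germ_rel_iff)
    obtain j a b where j: "j \<in> carrier G" "a \<in> carrier S" "b \<in> carrier S"
      "k = j \<otimes>\<^bsub>G\<^esub> \<iota> a" "k' = j \<otimes>\<^bsub>G\<^esub> \<iota> b" "a \<otimes>\<^bsub>S\<^esub> t = b \<otimes>\<^bsub>S\<^esub> s'"
      using common_refinementE[of k k' t s'] k k' by metis
    have "lam (a \<otimes>\<^bsub>S\<^esub> s) x = lam (b \<otimes>\<^bsub>S\<^esub> t') z"
      using k(2,3,6) k'(2,3,6) j(2,3,6) p(3) q(3) r(3) by (metis lam_S_mult)
    moreover have "g = j \<otimes>\<^bsub>G\<^esub> \<iota> (a \<otimes>\<^bsub>S\<^esub> s)" "m = j \<otimes>\<^bsub>G\<^esub> \<iota> (b \<otimes>\<^bsub>S\<^esub> t')"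
      using k(2,4) k'(3,5) j(1-5) by (simp_all add: mult_\<iota>_mult)
    ultimately show "(p, r) \<in> germ_rel"
      unfolding p(1) r(1) germ_rel_iff[OF p(2) r(2) p(3) r(3)]
      using j(1-3) k(2) k'(3) S.m_closed by blast
  qed
qed

lemma germ_eq_iff:
  assumes "g \<in> carrier G" "h \<in> carrier G" "x \<in> carrier X" "y \<in> carrier X"
  shows "germ g x = germ h y \<longleftrightarrow> (\<exists>k\<in>carrier G. \<exists>s\<in>carrier S. \<exists>t\<in>carrier S.
       g = k \<otimes>\<^bsub>G\<^esub> \<iota> s \<and> h = k \<otimes>\<^bsub>G\<^esub> \<iota> t \<and> lam s x = lam t y)"
  using eq_equiv_class_iff[OF equiv_germ_rel, of "(g, coset x)" "(h, coset y)"] assms germ_rel_iff[OF assms]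
  by (simp add: germ_eq_Image)

text \<open>This is how a germ is raised to a higher index; together with
  \<open>upper_boundE\<close> it brings any two germs to a common one.\<close>

lemma germ_lam:
  assumes "k \<in> carrier G" "s \<in> carrier S" "x \<in> carrier X"
  shows "germ (k \<otimes>\<^bsub>G\<^esub> \<iota> s) x = germ k (lam s x)"
proof -
  have "\<exists>k'\<in>carrier G. \<exists>s'\<in>carrier S. \<exists>t\<in>carrier S.
       k \<otimes>\<^bsub>G\<^esub> \<iota> s = k' \<otimes>\<^bsub>G\<^esub> \<iota> s' \<and> k = k' \<otimes>\<^bsub>G\<^esub> \<iota> t \<and> lam s' x = lam t (lam s x)"
    using assms by (intro bexI[of _ k] bexI[of _ s] bexI[of _ "\<one>\<^bsub>S\<^esub>"]) auto
  then show ?thesis using assms by (subst germ_eq_iff) auto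
qed

lemma carrier_localization:
  "carrier (ore_localization S G \<iota> X lam) = {germ g x | g x. g \<in> carrier G \<and> x \<in> carrier X}"
proof -
  have "carrier (ore_localization S G \<iota> X lam) = (carrier G \<times> coset ` carrier X) // germ_rel"
    by (simp add: ore_localization_def direct_limit_def germ_rel_def carrier_reduced)
  then show ?thesis by (auto simp: quotient_def germ_eq_Image)
qed

lemma in_localizationE:
  assumes "P \<in> carrier (ore_localization S G \<iota> X lam)"
  obtains g x where "g \<in> carrier G" "x \<in> carrier X" "P = germ g x"
  using assms by (auto simp: carrier_localization)

lemma germ_closed [simp]:
  "g \<in> carrier G \<Longrightarrow> x \<in> carrier X \<Longrightarrow> germ g x \<in> carrier (ore_localization S G \<iota> X lam)"
  by (auto simp: carrier_localization)

text \<open>The two equalities of germs come with different upper bounds and different elements of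
  \<open>S\<close>. Over a common refinement of the bounds, comparing the expressions for
  \<open>k\<close> and for \<open>g\<close> shows that one pair of elements of \<open>S\<close>
  serves both factors.\<close>

lemma germ_mult_cong:
  assumes G: "k \<in> carrier G" "g \<in> carrier G"
    and X: "a \<in> carrier X" "b \<in> carrier X" "x \<in> carrier X" "y \<in> carrier X"
    and eq: "germ k a = germ g x" "germ k b = germ g y"
  shows "germ k (a \<otimes>\<^bsub>X\<^esub> b) = germ g (x \<otimes>\<^bsub>X\<^esub> y)"
proof -
  obtain m s t where m: "m \<in> carrier G" "s \<in> carrier S" "t \<in> carrier S"
      "k = m \<otimes>\<^bsub>G\<^esub> \<iota> s" "g = m \<otimes>\<^bsub>G\<^esub> \<iota> t" "lam s a = lam t x"
    using eq(1) G X by (auto simp: germ_eq_iff)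
  obtain m' s' t' where m': "m' \<in> carrier G" "s' \<in> carrier S" "t' \<in> carrier S"
      "k = m' \<otimes>\<^bsub>G\<^esub> \<iota> s'" "g = m' \<otimes>\<^bsub>G\<^esub> \<iota> t'" "lam s' b = lam t' y"
    using eq(2) G X by (auto simp: germ_eq_iff)
  obtain j p q where j: "j \<in> carrier G" "p \<in> carrier S" "q \<in> carrier S"
      "m = j \<otimes>\<^bsub>G\<^esub> \<iota> p" "m' = j \<otimes>\<^bsub>G\<^esub> \<iota> q" "p \<otimes>\<^bsub>S\<^esub> s = q \<otimes>\<^bsub>S\<^esub> s'"
    using common_refinementE[of m m' s s'] m m' by metis
  have gk: "k = j \<otimes>\<^bsub>G\<^esub> \<iota> (p \<otimes>\<^bsub>S\<^esub> s)" "g = j \<otimes>\<^bsub>G\<^esub> \<iota> (p \<otimes>\<^bsub>S\<^esub> t)" "g = j \<otimes>\<^bsub>G\<^esub> \<iota> (q \<otimes>\<^bsub>S\<^esub> t')"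
    using m m' j(1-5) by (simp_all add: mult_\<iota>_mult)
  then have "p \<otimes>\<^bsub>S\<^esub> t = q \<otimes>\<^bsub>S\<^esub> t'"
    using m(3) m'(3) j(1-3) by simp
  then have "lam (p \<otimes>\<^bsub>S\<^esub> s) b = lam (p \<otimes>\<^bsub>S\<^esub> t) y"
    using j m' X by (simp add: lam_S_mult)
  moreover have "lam (p \<otimes>\<^bsub>S\<^esub> s) a = lam (p \<otimes>\<^bsub>S\<^esub> t) x"
    using j(2) m(2,3,6) X by (simp add: lam_S_mult)
  ultimately have "lam (p \<otimes>\<^bsub>S\<^esub> s) (a \<otimes>\<^bsub>X\<^esub> b) = lam (p \<otimes>\<^bsub>S\<^esub> t) (x \<otimes>\<^bsub>X\<^esub> y)"
    using j(2) m(2,3) X by simp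
  then show ?thesis
    using gk(1,2) j(1,2) m(2,3) X G S.m_closed by (subst germ_eq_iff) blast+
qed

lemma in_germE:
  assumes "(i, u) \<in> germ g x"
  obtains a where "u = coset a" "a \<in> carrier X" "i \<in> carrier G" "germ i a = germ g x"
proof -
  have germ_rel: "((g, coset x), (i, u)) \<in> germ_rel"
    using assms by (simp add: germ_eq_Image)
  then obtain a where "u = coset a" "a \<in> carrier X" "i \<in> carrier G"
    using germ_rel_carrier by blast
  then show ?thesis
    using that equiv_class_eq[OF equiv_germ_rel germ_rel] by (simp add: germ_eq_Image)
qed

text \<open>The product is defined as a union of classes over all representatives and all upper
  bounds, so the task is to show that the set of these classes is a singleton.\<close>

lemma mult_localization:
  assumes "g \<in> carrier G" "x \<in> carrier X" "y \<in> carrier X"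
  shows "germ g x \<otimes>\<^bsub>ore_localization S G \<iota> X lam\<^esub> germ g y = germ g (x \<otimes>\<^bsub>X\<^esub> y)"
proof -
  let ?M = "{ore_localization_map S G \<iota> X lam k
       (reduced_action S X lam (fraction_quotient S G \<iota> i k) u \<otimes>\<^bsub>reduced_group S X lam\<^esub>
        reduced_action S X lam (fraction_quotient S G \<iota> j k) v) | i u j v k.
       (i, u) \<in> germ g x \<and> (j, v) \<in> germ g y \<and> k \<in> carrier G \<and>
       fraction_le S G \<iota> i k \<and> fraction_le S G \<iota> j k}"
  have "germ g x \<otimes>\<^bsub>ore_localization S G \<iota> X lam\<^esub> germ g y = \<Union> ?M"
    by (simp add: ore_localization_def direct_limit_def ore_localization_map_def)
  also have "?M = {germ g (x \<otimes>\<^bsub>X\<^esub> y)}"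
  proof (intro equalityI subsetI)
    fix P assume "P \<in> ?M"
    then obtain i u j v k where P: "P = ore_localization_map S G \<iota> X lam k
       (reduced_action S X lam (fraction_quotient S G \<iota> i k) u \<otimes>\<^bsub>reduced_group S X lam\<^esub>
        reduced_action S X lam (fraction_quotient S G \<iota> j k) v)"
      and iu: "(i, u) \<in> germ g x" and jv: "(j, v) \<in> germ g y" and k: "k \<in> carrier G"
      and le: "fraction_le S G \<iota> i k" "fraction_le S G \<iota> j k"
      by blast
    obtain a where a: "u = coset a" "a \<in> carrier X" "i \<in> carrier G" "germ i a = germ g x"
      using in_germE[OF iu] .
    obtain b where b: "v = coset b" "b \<in> carrier X" "j \<in> carrier G" "germ j b = germ g y"
      using in_germE[OF jv] .
    obtain s where s: "s \<in> carrier S" "i = k \<otimes>\<^bsub>G\<^esub> \<iota> s"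
      using le(1) a(3) k fraction_le_iff by blast
    obtain t where t: "t \<in> carrier S" "j = k \<otimes>\<^bsub>G\<^esub> \<iota> t"
      using le(2) b(3) k fraction_le_iff by blast
    have "P = germ k (lam s a \<otimes>\<^bsub>X\<^esub> lam t b)"
      using P a b k s t by (simp add: reduced_action_coset mult_reduced germ_def)
    also have "\<dots> = germ g (x \<otimes>\<^bsub>X\<^esub> y)"
      using a b k s t assms germ_lam by (intro germ_mult_cong) auto
    finally show "P \<in> {germ g (x \<otimes>\<^bsub>X\<^esub> y)}" by simp
  next
    fix P assume "P \<in> {germ g (x \<otimes>\<^bsub>X\<^esub> y)}"
    \<comment> \<open>For nonemptiness, the representatives at \<open>g\<close> itself are used with
      \<open>g\<close> as its own upper bound, the transition map being that of the unit.\<close>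
    have g: "g = g \<otimes>\<^bsub>G\<^esub> \<iota> \<one>\<^bsub>S\<^esub>" using assms by simp
    have mem: "(g, coset x) \<in> germ g x" "(g, coset y) \<in> germ g y"
      using assms equiv_class_self[OF equiv_germ_rel] by (auto simp: germ_eq_Image)
    have "fraction_le S G \<iota> g g" using assms g fraction_le_iff S.one_closed by blast
    moreover have "fraction_quotient S G \<iota> g g = \<one>\<^bsub>S\<^esub>"
      using fraction_quotient_mult[of g "\<one>\<^bsub>S\<^esub>"] assms by simp
    moreover have "P = germ g (x \<otimes>\<^bsub>X\<^esub> y)" using \<open>P \<in> _\<close> by simp
    ultimately have "P = ore_localization_map S G \<iota> X lam g
       (reduced_action S X lam (fraction_quotient S G \<iota> g g) (coset x) \<otimes>\<^bsub>reduced_group S X lam\<^esub>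
        reduced_action S X lam (fraction_quotient S G \<iota> g g) (coset y))"
      using assms by (simp add: reduced_action_coset mult_reduced germ_def)
    then show "P \<in> ?M"
      using mem assms(1) \<open>fraction_le S G \<iota> g g\<close> by blast
  qed
  finally show ?thesis by simp
qed

lemma localized_action_germ:
  "a \<in> carrier G \<Longrightarrow> g \<in> carrier G \<Longrightarrow> localized_action G a (germ g x) = germ (a \<otimes>\<^bsub>G\<^esub> g) x"
  by (simp add: germ_def localized_action_ore_localization_map G.is_group)

end


section \<open>The Ore colocalization\<close>

lemma carrier_discrete_group [simp]: "carrier (discrete_group A) = carrier A"
  and mult_discrete_group [simp]: "(\<otimes>\<^bsub>discrete_group A\<^esub>) = (\<otimes>\<^bsub>A\<^esub>)"
  and tp_discrete_group [simp]: "tp (discrete_group A) = discrete_topology (carrier A)"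
  by (simp_all add: discrete_group_def)

lemma in_characters_discrete_iff:
  "\<xi> \<in> characters (discrete_group A) \<longleftrightarrow> \<xi> \<in> extensional (carrier A) \<and>
     (\<forall>x\<in>carrier A. norm (\<xi> x) = 1) \<and>
     (\<forall>x\<in>carrier A. \<forall>y\<in>carrier A. \<xi> (x \<otimes>\<^bsub>A\<^esub> y) = \<xi> x * \<xi> y)"
  by (auto simp: in_characters_iff)

lemma topspace_dual [simp]: "topspace (tp (dual A)) = characters A"
proof -
  have "characters A \<in> {{\<xi> \<in> characters A. \<xi> ` C \<subseteq> U} | C U. compactin (tp A) C \<and> openin (tp circle) U}"
    by (rule CollectI, rule exI[of _ "{}"], rule exI[of _ "{}"]) auto
  then show ?thesis by (auto simp: tp_dual)
qed

lemma continuous_map_dual_eval: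
  assumes "x \<in> topspace (tp A)"
  shows "continuous_map (tp (dual A)) euclidean (\<lambda>\<xi>. \<xi> x)"
proof -
  have "continuous_map (tp (dual A)) (tp circle) (\<lambda>\<xi>. \<xi> x)"
    unfolding continuous_map_def
  proof (intro conjI allI impI)
    show "(\<lambda>\<xi>. \<xi> x) \<in> topspace (tp (dual A)) \<rightarrow> topspace (tp circle)"
      using assms by (auto simp: in_characters_iff)
    fix U assume U: "openin (tp circle) U"
    show "openin (tp (dual A)) {\<xi> \<in> topspace (tp (dual A)). \<xi> x \<in> U}"
      unfolding topspace_dual tp_dual
      by (rule topology_generated_by_Basis, rule CollectI, rule exI[of _ "{x}"], rule exI[of _ U])
        (use U assms in auto)
  qed
  then show ?thesis by (simp add: continuous_map_in_subtopology)
qed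

text \<open>Compact subsets of a discrete space are finite, so a subbasic open set of the
  compact-open topology imposes conditions at finitely many points only.\<close>

lemma continuous_map_into_dual_discrete:
  assumes chars: "f \<in> topspace T \<rightarrow> characters (discrete_group A)"
    and cont: "\<And>a. a \<in> carrier A \<Longrightarrow> continuous_map T euclidean (\<lambda>t. f t a)"
  shows "continuous_map T (tp (dual (discrete_group A))) f"
  unfolding tp_dual
proof (rule continuous_on_generated_topo)
  have "f ` topspace T \<subseteq> topspace (tp (dual (discrete_group A)))"
    using chars by auto
  then show "f ` topspace T \<subseteq> \<Union> {{\<xi> \<in> characters (discrete_group A). \<xi> ` C \<subseteq> U} | C U.
      compactin (tp (discrete_group A)) C \<and> openin (tp circle) U}"
    by (simp only: tp_dual topology_generated_by_topspace)
  fix W assume "W \<in> {{\<xi> \<in> characters (discrete_group A). \<xi> ` C \<subseteq> U} | C U.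
      compactin (tp (discrete_group A)) C \<and> openin (tp circle) U}"
  then obtain C U where W: "W = {\<xi> \<in> characters (discrete_group A). \<xi> ` C \<subseteq> U}"
    and C: "finite C" "C \<subseteq> carrier A" and U: "openin (tp circle) U"
    by (auto simp: compactin_discrete_topology)
  have "openin T {t \<in> topspace T. f t a \<in> U}" if "a \<in> C" for a
  proof (rule openin_continuous_map_preimage[OF _ U])
    have "norm (f t a) = 1" if "t \<in> topspace T" for t
      using that chars C(2) \<open>a \<in> C\<close> by (auto simp: Pi_iff in_characters_discrete_iff)
    then show "continuous_map T (tp circle) (\<lambda>t. f t a)"
      using cont C(2) that by (auto simp: continuous_map_in_subtopology)
  qed
  \<comment> \<open>The intersection with the whole space takes care of empty
    \<open>C\<close>.\<close>
  then have "openin T ((\<Inter>a\<in>C. {t \<in> topspace T. f t a \<in> U}) \<inter> topspace T)"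
    by (intro openin_INT C) auto
  moreover have "(\<Inter>a\<in>C. {t \<in> topspace T. f t a \<in> U}) \<inter> topspace T = f -` W \<inter> topspace T"
    using chars by (auto simp: W)
  ultimately show "openin T (f -` W \<inter> topspace T)" by simp
qed

lemma conjugatedI:
  assumes "f \<in> hom A B" and fg: "homeomorphic_maps (tp A) (tp B) f g"
    and top: "topspace (tp A) = carrier A" "topspace (tp B) = carrier B"
    and "\<And>g x. g \<in> carrier G \<Longrightarrow> x \<in> carrier A \<Longrightarrow> f (\<alpha> g x) = \<beta> g (f x)"
  shows "conjugated G A \<alpha> B \<beta>"
proof -
  have f: "homeomorphic_map (tp A) (tp B) f"
    using fg homeomorphic_map_maps by blast
  then have "f \<in> iso A B"
    using assms(1) top homeomorphic_imp_injective_map[OF f] homeomorphic_imp_surjective_map[OF f] by (simp add: iso_def bij_betw_def)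
  then show ?thesis
    unfolding conjugated_def using f assms(5) by blast
qed

section \<open>Compatible families and the inverse limit\<close>

locale ore_right_action = left_fractions S G \<iota>
  for S :: "('s, 'm) monoid_scheme" and G :: "('g, 'n) monoid_scheme" and \<iota> :: "'s \<Rightarrow> 'g" +
  fixes K :: "'k top_group" and \<rho> :: "'s \<Rightarrow> 'k \<Rightarrow> 'k"
  assumes right_action: "right_action S K \<rho>"
begin

abbreviation "Kstar \<equiv> ore_colocalization S G \<iota> K \<rho>"

lemma \<rho>_closed [simp, intro]: "s \<in> carrier S \<Longrightarrow> x \<in> carrier K \<Longrightarrow> \<rho> s x \<in> carrier K"
  using right_action by (auto simp: right_action_def hom_def)

lemma \<rho>_mult: "s \<in> carrier S \<Longrightarrow> x \<in> carrier K \<Longrightarrow> y \<in> carrier K \<Longrightarrow>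
    \<rho> s (x \<otimes>\<^bsub>K\<^esub> y) = \<rho> s x \<otimes>\<^bsub>K\<^esub> \<rho> s y"
  using right_action by (auto simp: right_action_def hom_def)

lemma \<rho>_continuous: "s \<in> carrier S \<Longrightarrow> continuous_map (tp K) (tp K) (\<rho> s)"
  using right_action by (auto simp: right_action_def)

lemma \<rho>_S_one: "x \<in> carrier K \<Longrightarrow> \<rho> \<one>\<^bsub>S\<^esub> x = x"
  using right_action by (auto simp: right_action_def)

lemma \<rho>_S_mult: "s \<in> carrier S \<Longrightarrow> t \<in> carrier S \<Longrightarrow> x \<in> carrier K \<Longrightarrow>
    \<rho> (s \<otimes>\<^bsub>S\<^esub> t) x = \<rho> t (\<rho> s x)"
  using right_action by (auto simp: right_action_def)

text \<open>Compatibility is split by the upper index, so that families satisfying it at one index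
  only can be considered later. At \<open>h\<close> it says that all components below
  \<open>h\<close> are determined by the one at \<open>h\<close>.\<close>

definition compatible where
  "compatible h k \<longleftrightarrow> (\<forall>s\<in>carrier S. k (h \<otimes>\<^bsub>G\<^esub> \<iota> s) = \<rho> s (k h))"

lemma compatible_all_iff:
  "(\<forall>h\<in>carrier G. compatible h k) \<longleftrightarrow>
    (\<forall>g\<in>carrier G. \<forall>h\<in>carrier G. fraction_le S G \<iota> g h \<longrightarrow> \<rho> (fraction_quotient S G \<iota> g h) (k h) = k g)"
proof
  assume "\<forall>h\<in>carrier G. compatible h k"
  then show "\<forall>g\<in>carrier G. \<forall>h\<in>carrier G. fraction_le S G \<iota> g h \<longrightarrow>
      \<rho> (fraction_quotient S G \<iota> g h) (k h) = k g"
    by (auto simp: compatible_def fraction_le_iff)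
next
  assume *: "\<forall>g\<in>carrier G. \<forall>h\<in>carrier G. fraction_le S G \<iota> g h \<longrightarrow>
      \<rho> (fraction_quotient S G \<iota> g h) (k h) = k g"
  show "\<forall>h\<in>carrier G. compatible h k"
    unfolding compatible_def
  proof (intro ballI)
    fix h s assume "h \<in> carrier G" "s \<in> carrier S"
    then show "k (h \<otimes>\<^bsub>G\<^esub> \<iota> s) = \<rho> s (k h)"
      using *[rule_format, of "h \<otimes>\<^bsub>G\<^esub> \<iota> s" h] by (auto simp: fraction_le_iff)
  qed
qed

text \<open>A compatible family takes its values in the core without further assumptions, because its
  component at \<open>g\<close> is the image under \<open>\<rho> t\<close> of its component at \<open>g t^-1\<close>.\<close>

lemma carrier_colocalization:
  "carrier Kstar = {k \<in> carrier G \<rightarrow>\<^sub>E carrier K. \<forall>h\<in>carrier G. compatible h k}"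
proof -
  let ?C = "\<Inter>t\<in>carrier S. \<rho> t ` carrier K"
  have "\<rho> \<one>\<^bsub>S\<^esub> ` carrier K = carrier K" by (auto simp: \<rho>_S_one)
  then have C: "?C \<subseteq> carrier K" using S.one_closed by blast
  have eq: "carrier Kstar = {k \<in> carrier G \<rightarrow>\<^sub>E ?C.
      \<forall>g\<in>carrier G. \<forall>h\<in>carrier G. fraction_le S G \<iota> g h \<longrightarrow> \<rho> (fraction_quotient S G \<iota> g h) (k h) = k g}"
    by (simp add: ore_colocalization_def inverse_limit_def core_group_def Let_def)
  show ?thesis
  proof (intro equalityI subsetI)
    fix k assume "k \<in> carrier Kstar"
    then show "k \<in> {k \<in> carrier G \<rightarrow>\<^sub>E carrier K. \<forall>h\<in>carrier G. compatible h k}"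
      using C compatible_all_iff[of k] by (auto simp: eq PiE_iff)
  next
    fix k assume k: "k \<in> {k \<in> carrier G \<rightarrow>\<^sub>E carrier K. \<forall>h\<in>carrier G. compatible h k}"
    have "k g \<in> \<rho> t ` carrier K" if "g \<in> carrier G" "t \<in> carrier S" for g t
    proof -
      let ?h = "g \<otimes>\<^bsub>G\<^esub> inv\<^bsub>G\<^esub> (\<iota> t)"
      have "?h \<in> carrier G" "g = ?h \<otimes>\<^bsub>G\<^esub> \<iota> t"
        using that by (auto simp: G.m_assoc)
      then have "k g = \<rho> t (k ?h)" "k ?h \<in> carrier K"
        using k that(2) by (metis (no_types, lifting) compatible_def mem_Collect_eq, auto)
      then show ?thesis by blast
    qed
    then have "k \<in> carrier G \<rightarrow>\<^sub>E ?C"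
      using k by (auto simp: PiE_iff)
    then show "k \<in> carrier Kstar"
      using k compatible_all_iff[of k] by (auto simp: eq)
  qed
qed

lemma mult_colocalization [simp]:
  "(\<otimes>\<^bsub>Kstar\<^esub>) = (\<lambda>k l. \<lambda>g\<in>carrier G. k g \<otimes>\<^bsub>K\<^esub> l g)"
  by (simp add: ore_colocalization_def inverse_limit_def core_group_def Let_def)

text \<open>\<open>K*\<close> lies in the product of the cores, and the product of subspace
  topologies is the subspace topology of the product.\<close>

lemma tp_colocalization:
  "tp Kstar = subtopology (product_topology (\<lambda>g. tp K) (carrier G)) (carrier Kstar)"
proof -
  let ?C = "\<Inter>t\<in>carrier S. \<rho> t ` carrier K"
  have sub: "carrier Kstar \<subseteq> carrier G \<rightarrow>\<^sub>E ?C"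
    by (auto simp: ore_colocalization_def inverse_limit_def core_group_def Let_def)
  have "tp Kstar = subtopology (product_topology (\<lambda>g. subtopology (tp K) ?C) (carrier G)) (carrier Kstar)"
    by (simp add: ore_colocalization_def inverse_limit_def core_group_def Let_def)
  also have "\<dots> = subtopology (product_topology (\<lambda>g. tp K) (carrier G)) (carrier Kstar)"
    using sub by (simp add: subtopology_subtopology inf.absorb2 flip: subtopology_product_topology)
  finally show ?thesis .
qed

end


section \<open>The dual of the localization\<close>

context ore_left_action
begin

abbreviation "Xstar \<equiv> discrete_group (ore_localization S G \<iota> X lam)"

lemma compose_character:
  assumes "\<xi> \<in> characters (discrete_group X)" "s \<in> carrier S"
  shows "compose (carrier X) \<xi> (lam s) \<in> characters (discrete_group X)"
  using assms by (auto simp: in_characters_discrete_iff compose_def)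

lemma right_action_dual:
  "right_action S (dual (discrete_group X)) (dual_action (discrete_group X) lam)"
  unfolding right_action_def
proof (intro conjI ballI)
  fix s assume s: "s \<in> carrier S"
  show "dual_action (discrete_group X) lam s \<in> hom (dual (discrete_group X)) (dual (discrete_group X))"
    using s compose_character by (auto simp: hom_def dual_action_def compose_def)
  have ev: "continuous_map (tp (dual (discrete_group X))) euclidean (\<lambda>\<xi>. \<xi> (lam s a))" if "a \<in> carrier X" for a
    using s that by (intro continuous_map_dual_eval) auto
  show "continuous_map (tp (dual (discrete_group X))) (tp (dual (discrete_group X)))
      (dual_action (discrete_group X) lam s)"
    using compose_character s ev
    by (intro continuous_map_into_dual_discrete) (auto simp: dual_action_def compose_def)
next
  fix \<xi> assume \<xi>: "\<xi> \<in> carrier (dual (discrete_group X))"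
  then show "dual_action (discrete_group X) lam \<one>\<^bsub>S\<^esub> \<xi> = \<xi>"
    by (auto simp: dual_action_def compose_def in_characters_discrete_iff extensional_def)
  fix s t assume "s \<in> carrier S" "t \<in> carrier S"
  then show "dual_action (discrete_group X) lam (s \<otimes>\<^bsub>S\<^esub> t) \<xi> =
      dual_action (discrete_group X) lam t (dual_action (discrete_group X) lam s \<xi>)"
    by (auto simp: dual_action_def compose_def lam_S_mult)
qed

sublocale D: ore_right_action S G \<iota> "dual (discrete_group X)" "dual_action (discrete_group X) lam"
  by unfold_locales (rule right_action_dual)

lemma D_compatible_iff:
  assumes "h \<in> carrier G" "k h \<in> characters (discrete_group X)"
  shows "D.compatible h k \<longleftrightarrow> (\<forall>s\<in>carrier S. k (h \<otimes>\<^bsub>G\<^esub> \<iota> s) = (\<lambda>x\<in>carrier X. k h (lam s x)))"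
  by (simp add: D.compatible_def dual_action_def compose_def)

definition to_family where
  "to_family \<xi> = (\<lambda>g\<in>carrier G. \<lambda>x\<in>carrier X. \<xi> (germ g x))"

definition of_family where
  "of_family k = (\<lambda>P\<in>carrier Xstar.
     case (SOME (g, x). g \<in> carrier G \<and> x \<in> carrier X \<and> P = germ g x) of (g, x) \<Rightarrow> k g x)"

lemma to_family_closed:
  assumes "\<xi> \<in> characters Xstar"
  shows "to_family \<xi> \<in> carrier D.Kstar"
proof -
  have "(\<lambda>x\<in>carrier X. \<xi> (germ g x)) \<in> characters (discrete_group X)" if "g \<in> carrier G" for g
    using assms that by (auto simp: in_characters_discrete_iff simp flip: mult_localization)
  then show ?thesis
    by (auto simp: D.carrier_colocalization to_family_def D_compatible_iff germ_lam)
qed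

text \<open>The value does not depend on the chosen representative: if
  \<open>germ g x = germ h y\<close> is witnessed at \<open>m\<close>, compatibility at
  \<open>m\<close> turns \<open>k g x\<close> and \<open>k h y\<close> into the values of
  \<open>k m\<close> at \<open>lam s x\<close> and \<open>lam t y\<close>, which are equal.\<close>

lemma of_family_germ:
  assumes k: "k \<in> carrier D.Kstar" and gx: "g \<in> carrier G" "x \<in> carrier X"
  shows "of_family k (germ g x) = k g x"
proof -
  have wd: "k g x = k h y" if hy: "h \<in> carrier G" "y \<in> carrier X" and eq: "germ g x = germ h y" for h y
  proof -
    obtain m s t where m: "m \<in> carrier G" "s \<in> carrier S" "t \<in> carrier S"
      "g = m \<otimes>\<^bsub>G\<^esub> \<iota> s" "h = m \<otimes>\<^bsub>G\<^esub> \<iota> t" "lam s x = lam t y"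
      using eq[unfolded germ_eq_iff[OF gx(1) hy(1) gx(2) hy(2)]] by blast
    have "D.compatible m k" "k m \<in> characters (discrete_group X)"
      using k m by (auto simp: D.carrier_colocalization)
    then show ?thesis
      using m gx hy by (simp add: D_compatible_iff)
  qed
  define p where "p = (SOME (h, y). h \<in> carrier G \<and> y \<in> carrier X \<and> germ g x = germ h y)"
  have "case p of (h, y) \<Rightarrow> h \<in> carrier G \<and> y \<in> carrier X \<and> germ g x = germ h y"
    unfolding p_def by (rule someI[of _ "(g, x)"]) (use gx in auto)
  moreover obtain h y where p: "p = (h, y)" by (cases p)
  ultimately have "k g x = k h y"
    by (intro wd) simp_all
  moreover have "of_family k (germ g x) = (case p of (h, y) \<Rightarrow> k h y)"
    unfolding of_family_def p_def by (rule restrict_apply') (simp add: gx)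
  ultimately show ?thesis by (simp add: p)
qed

lemma of_family_closed:
  assumes k: "k \<in> carrier D.Kstar"
  shows "of_family k \<in> characters Xstar"
proof -
  have ch: "k g \<in> characters (discrete_group X)" if "g \<in> carrier G" for g
    using k that by (auto simp: D.carrier_colocalization)
  have "of_family k (P \<otimes>\<^bsub>ore_localization S G \<iota> X lam\<^esub> Q) = of_family k P * of_family k Q"
    if P: "P \<in> carrier (ore_localization S G \<iota> X lam)" and Q: "Q \<in> carrier (ore_localization S G \<iota> X lam)" for P Q
  proof -
    obtain g x where g: "g \<in> carrier G" "x \<in> carrier X" "P = germ g x" using in_localizationE[OF P] .
    obtain h y where h: "h \<in> carrier G" "y \<in> carrier X" "Q = germ h y" using in_localizationE[OF Q] .
    obtain m s t where m: "m \<in> carrier G" "s \<in> carrier S" "t \<in> carrier S"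
      "g = m \<otimes>\<^bsub>G\<^esub> \<iota> s" "h = m \<otimes>\<^bsub>G\<^esub> \<iota> t"
      using upper_boundE[OF g(1) h(1)] .
    \<comment> \<open>On germs at the single index \<open>m\<close>, \<open>of_family k\<close> is
      given by the character \<open>k m\<close>, so multiplicativity is inherited from it.\<close>
    have "P = germ m (lam s x)" "Q = germ m (lam t y)"
      using g h m by (simp_all add: germ_lam)
    then show ?thesis
      using ch[OF m(1)] g(2) h(2) m(1-3)
      by (simp add: mult_localization of_family_germ[OF k] in_characters_discrete_iff)
  qed
  moreover have "norm (of_family k P) = 1" if P: "P \<in> carrier (ore_localization S G \<iota> X lam)" for P
  proof -
    obtain g x where "g \<in> carrier G" "x \<in> carrier X" "P = germ g x" using in_localizationE[OF P] .
    then show ?thesis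
      using ch by (simp add: of_family_germ[OF k] in_characters_discrete_iff)
  qed
  ultimately show ?thesis
    by (auto simp: in_characters_discrete_iff of_family_def)
qed

lemma conjugated_dual_localization:
  "conjugated G (dual Xstar) (dual_action Xstar (localized_action G)) D.Kstar (colocalized_action G)"
proof (rule conjugatedI)
  have top_K: "topspace (tp D.Kstar) = carrier D.Kstar"
    by (auto simp: D.tp_colocalization D.carrier_colocalization)
  then show "topspace (tp D.Kstar) = carrier D.Kstar" .
  show "topspace (tp (dual Xstar)) = carrier (dual Xstar)" by simp
  show "to_family \<in> hom (dual Xstar) D.Kstar"
  proof (rule homI)
    fix \<xi> \<eta>
    show "to_family (\<xi> \<otimes>\<^bsub>dual Xstar\<^esub> \<eta>) = to_family \<xi> \<otimes>\<^bsub>D.Kstar\<^esub> to_family \<eta>"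
      unfolding to_family_def D.mult_colocalization mult_dual
      by (intro restrict_ext) (simp cong: restrict_cong)
  qed (use to_family_closed in simp)
  have "continuous_map (tp (dual Xstar)) (product_topology (\<lambda>g. tp (dual (discrete_group X))) (carrier G)) to_family"
    unfolding continuous_map_componentwise
  proof (intro conjI ballI)
    show "to_family ` topspace (tp (dual Xstar)) \<subseteq> extensional (carrier G)"
      by (auto simp: to_family_def)
    fix g assume g: "g \<in> carrier G"
    show "continuous_map (tp (dual Xstar)) (tp (dual (discrete_group X))) (\<lambda>\<xi>. to_family \<xi> g)"
    proof (rule continuous_map_into_dual_discrete)
      show "(\<lambda>\<xi>. to_family \<xi> g) \<in> topspace (tp (dual Xstar)) \<rightarrow> characters (discrete_group X)"
        using to_family_closed g by (fastforce simp: D.carrier_colocalization)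
      fix a assume "a \<in> carrier X"
      then show "continuous_map (tp (dual Xstar)) euclidean (\<lambda>\<xi>. to_family \<xi> g a)"
        using g continuous_map_dual_eval[of "germ g a" Xstar] by (simp add: to_family_def)
    qed
  qed
  then have "continuous_map (tp (dual Xstar)) (tp D.Kstar) to_family"
    using to_family_closed by (simp add: D.tp_colocalization continuous_map_in_subtopology Pi_iff)
  moreover have "continuous_map (tp D.Kstar) (tp (dual Xstar)) of_family"
  proof (rule continuous_map_into_dual_discrete)
    show "of_family \<in> topspace (tp D.Kstar) \<rightarrow> characters Xstar"
      using of_family_closed top_K by auto
    fix P assume "P \<in> carrier (ore_localization S G \<iota> X lam)"
    then obtain g x where gx: "g \<in> carrier G" "x \<in> carrier X" "P = germ g x" using in_localizationE by blast
    have "continuous_map (tp D.Kstar) (tp (dual (discrete_group X))) (\<lambda>k. k g)"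
      unfolding D.tp_colocalization
      by (intro continuous_map_from_subtopology continuous_map_product_projection gx)
    moreover have "continuous_map (tp (dual (discrete_group X))) euclidean (\<lambda>\<xi>. \<xi> x)"
      by (rule continuous_map_dual_eval) (use gx in simp)
    ultimately have "continuous_map (tp D.Kstar) euclidean ((\<lambda>\<xi>. \<xi> x) \<circ> (\<lambda>k. k g))"
      by (rule continuous_map_compose)
    then show "continuous_map (tp D.Kstar) euclidean (\<lambda>k. of_family k P)"
      by (rule continuous_map_eq) (use gx top_K of_family_germ in auto)
  qed
  moreover have "of_family (to_family \<xi>) = \<xi>" if "\<xi> \<in> characters Xstar" for \<xi>
  proof (rule extensionalityI)
    show "of_family (to_family \<xi>) \<in> extensional (carrier Xstar)"
      by (simp add: of_family_def)
    show "\<xi> \<in> extensional (carrier Xstar)"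
      using that by (simp add: in_characters_discrete_iff)
    fix P assume "P \<in> carrier Xstar"
    then obtain g x where gx: "g \<in> carrier G" "x \<in> carrier X" "P = germ g x"
      using in_localizationE by (metis carrier_discrete_group)
    then show "of_family (to_family \<xi>) P = \<xi> P"
      using of_family_germ[OF to_family_closed[OF that]] by (simp add: to_family_def)
  qed
  moreover have "to_family (of_family k) = k" if k: "k \<in> carrier D.Kstar" for k
  proof (rule extensionalityI[where A = "carrier G"])
    show "k \<in> extensional (carrier G)" using k by (auto simp: D.carrier_colocalization PiE_iff)
    fix g assume g: "g \<in> carrier G"
    then have "k g \<in> extensional (carrier X)"
      using k by (auto simp: D.carrier_colocalization in_characters_discrete_iff)
    then have "(\<lambda>x\<in>carrier X. k g x) = k g" by (rule extensional_restrict)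
    moreover have "to_family (of_family k) g = (\<lambda>x\<in>carrier X. k g x)"
      using g of_family_germ[OF k g] by (auto simp: to_family_def)
    ultimately show "to_family (of_family k) g = k g" by simp
  qed (simp add: to_family_def)
  ultimately show "homeomorphic_maps (tp (dual Xstar)) (tp D.Kstar) to_family of_family"
    by (simp add: homeomorphic_maps_def top_K)
  fix a \<xi> assume a: "a \<in> carrier G" and "\<xi> \<in> carrier (dual Xstar)"
  \<comment> \<open>At \<open>g\<close> and \<open>x\<close> both sides are the value of
    \<open>\<xi>\<close> at \<open>germ (a g) x\<close>: the two actions of \<open>G\<close> shift
    the index in the same way.\<close>
  show "to_family (dual_action Xstar (localized_action G) a \<xi>) = colocalized_action G a (to_family \<xi>)"
    unfolding to_family_def dual_action_def colocalized_action_def compose_def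
    using a by (intro restrict_ext) (simp add: localized_action_germ cong: restrict_cong)
qed

end


section \<open>The dual of the colocalization\<close>

lemma comm_group_dual:
  assumes A: "topological_ab_group A"
  shows "comm_group (dual A)"
proof (rule comm_groupI)
  interpret comm_group A using A by (simp add: topological_ab_group_def)
  have top: "topspace (tp A) = carrier A" using A by (simp add: topological_ab_group_def)
  fix \<xi> assume \<xi>: "\<xi> \<in> carrier (dual A)"
  have cont: "continuous_map (tp A) euclidean (\<lambda>x\<in>carrier A. h (\<xi> x))" if "continuous_on UNIV h" for h
  proof (rule continuous_map_eq)
    show "continuous_map (tp A) euclidean (\<lambda>x. h (\<xi> x))"
      by (rule continuous_map_compose_euclidean[OF _ _ that]) (use \<xi> in \<open>simp_all add: in_characters_iff\<close>)
  qed (simp add: top)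
  have "continuous_map (tp A) euclidean (\<lambda>x\<in>carrier A. cnj (\<xi> x))"
    by (intro cont continuous_intros)
  then have "(\<lambda>x\<in>carrier A. cnj (\<xi> x)) \<in> characters A"
    using \<xi> by (auto simp: in_characters_iff top)
  moreover have "cnj (\<xi> x) * \<xi> x = 1" if "x \<in> carrier A" for x
    using \<xi> that by (simp add: in_characters_iff mult.commute flip: complex_norm_square)
  ultimately show "\<exists>\<eta>\<in>carrier (dual A). \<eta> \<otimes>\<^bsub>dual A\<^esub> \<xi> = \<one>\<^bsub>dual A\<^esub>"
    by (intro bexI[of _ "\<lambda>x\<in>carrier A. cnj (\<xi> x)"]) (simp_all cong: restrict_cong)
  show "\<one>\<^bsub>dual A\<^esub> \<otimes>\<^bsub>dual A\<^esub> \<xi> = \<xi>"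
    using \<xi> by (auto simp: in_characters_iff extensional_restrict cong: restrict_cong)
  fix \<eta> assume \<eta>: "\<eta> \<in> carrier (dual A)"
  have "continuous_map (tp A) euclidean (\<lambda>x\<in>carrier A. \<xi> x * \<eta> x)"
  proof (rule continuous_map_eq)
    show "continuous_map (tp A) euclidean (\<lambda>x. \<xi> x * \<eta> x)"
      using \<xi> \<eta> by (intro continuous_map_times) (auto simp: in_characters_iff)
  qed (simp add: top)
  then show "\<xi> \<otimes>\<^bsub>dual A\<^esub> \<eta> \<in> carrier (dual A)"
    using \<xi> \<eta> by (auto simp: in_characters_iff top norm_mult)
  show "\<xi> \<otimes>\<^bsub>dual A\<^esub> \<eta> = \<eta> \<otimes>\<^bsub>dual A\<^esub> \<xi>"
    by (simp add: mult.commute)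
  fix \<zeta> assume "\<zeta> \<in> carrier (dual A)"
  show "\<xi> \<otimes>\<^bsub>dual A\<^esub> \<eta> \<otimes>\<^bsub>dual A\<^esub> \<zeta> = \<xi> \<otimes>\<^bsub>dual A\<^esub> (\<eta> \<otimes>\<^bsub>dual A\<^esub> \<zeta>)"
    by (simp add: mult.assoc cong: restrict_cong)
next
  interpret comm_group A using A by (simp add: topological_ab_group_def)
  have top: "topspace (tp A) = carrier A" using A by (simp add: topological_ab_group_def)
  have "continuous_map (tp A) euclidean (\<lambda>x\<in>carrier A. 1 :: complex)"
    by (rule continuous_map_eq[of _ _ "\<lambda>x. 1"]) (auto simp: top)
  then show "\<one>\<^bsub>dual A\<^esub> \<in> carrier (dual A)"
    by (auto simp: in_characters_iff top)
qed

text \<open>A neighbourhood of \<open>\<xi>\<close> is built whose members are all at distance below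
  \<open>1\<close> from \<open>\<xi>\<close>, hence equal to it. Finitely many balls of radius
  \<open>1/4\<close> cover the circle, and their closures pull back to compact sets
  \<open>C z\<close>. A member of every \<open>V z\<close> maps \<open>C z\<close> to within
  \<open>1/2\<close> of \<open>z\<close>, so it differs from \<open>\<xi>\<close> by less than
  \<open>3/4\<close>.\<close>

lemma dual_compact_discrete:
  assumes A: "monoid A" "topspace (tp A) = carrier A" "compact_space (tp A)"
  shows "tp (dual A) = discrete_topology (characters A)"
proof -
  have "openin (tp (dual A)) {\<xi>}" if \<xi>: "\<xi> \<in> characters A" for \<xi>
  proof -
    obtain Z where Z: "finite Z" "sphere (0::complex) 1 \<subseteq> (\<Union>z\<in>Z. ball z (1/4))"
      using compact_sphere[of "0::complex" 1] unfolding compact_eq_totally_bounded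
      by (meson zero_less_divide_1_iff zero_less_numeral)
    define C where "C = (\<lambda>z. {x \<in> topspace (tp A). \<xi> x \<in> cball z (1/4)})"
    define V where "V = (\<lambda>z. {\<eta> \<in> characters A. \<eta> ` C z \<subseteq> ball z (1/2) \<inter> sphere 0 1})"
    have "openin (tp (dual A)) (V z)" for z
    proof -
      have "closedin (tp A) (C z)"
        unfolding C_def using \<xi> by (intro closedin_continuous_map_preimage) (auto simp: in_characters_iff)
      then have "compactin (tp A) (C z)"
        using A(3) closedin_compact_space by blast
      moreover have "openin (tp circle) (ball z (1/2) \<inter> sphere 0 1)"
        by (simp add: openin_open_Int Int_commute)
      ultimately show ?thesis
        unfolding tp_dual V_def by (intro topology_generated_by_Basis) blast
    qed
    then have "openin (tp (dual A)) ((\<Inter>z\<in>Z. V z) \<inter> topspace (tp (dual A)))"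
      by (intro openin_INT Z) auto
    moreover have "(\<Inter>z\<in>Z. V z) \<inter> topspace (tp (dual A)) = {\<xi>}"
    proof (intro equalityI subsetI)
      fix \<eta> assume \<eta>: "\<eta> \<in> (\<Inter>z\<in>Z. V z) \<inter> topspace (tp (dual A))"
      have "\<eta> x = \<xi> x" if x: "x \<in> carrier A" for x
      proof (rule close_hom_circle_eq[OF A(1) _ _ x])
        show "\<eta> \<in> hom A circle" "\<xi> \<in> hom A circle"
          using \<eta> \<xi> by (auto simp: characters_def)
        fix y assume y: "y \<in> carrier A"
        then have "\<xi> y \<in> sphere 0 1" using \<xi> by (simp add: in_characters_iff)
        then obtain z where z: "z \<in> Z" "dist z (\<xi> y) < 1/4" using Z(2) by auto
        then have "y \<in> C z" using y A(2) by (simp add: C_def)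
        then have "dist z (\<eta> y) < 1/2" using \<eta> z(1) unfolding V_def by fastforce
        then have "dist (\<eta> y) (\<xi> y) < 1"
          using z(2) dist_triangle2[of "\<eta> y" "\<xi> y" z] by (simp add: dist_commute)
        then show "norm (\<eta> y - \<xi> y) < 1" by (simp add: dist_norm)
      qed
      moreover have "\<eta> \<in> extensional (carrier A)" "\<xi> \<in> extensional (carrier A)"
        using \<eta> \<xi> by (auto simp: in_characters_iff)
      ultimately have "\<eta> = \<xi>" by (intro extensionalityI[of \<eta> "carrier A" \<xi>]) auto
      then show "\<eta> \<in> {\<xi>}" by simp
    next
      fix \<eta> assume "\<eta> \<in> {\<xi>}"
      moreover have "\<xi> \<in> V z" for z
        using \<xi> by (auto simp: V_def C_def in_characters_iff)
      ultimately show "\<eta> \<in> (\<Inter>z\<in>Z. V z) \<inter> topspace (tp (dual A))"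
        using \<xi> by auto
    qed
    ultimately show ?thesis by simp
  qed
  then have "discrete_topology (characters A) = tp (dual A)"
    by (subst discrete_topology_unique) simp
  then show ?thesis by simp
qed

text \<open>Real and imaginary parts are extended separately. The extension of a circle-valued
  function may leave the circle, which is why \<open>approximate_character\<close> starts from
  complex-valued functions.\<close>

lemma Tietze_extension_complex:
  fixes f :: "'a \<Rightarrow> complex"
  assumes "normal_space X" "closedin X C" "continuous_map (subtopology X C) euclidean f"
  obtains g where "continuous_map X euclidean g" "\<And>x. x \<in> C \<Longrightarrow> g x = f x"
proof -
  have *: "\<exists>g. continuous_map X euclideanreal g \<and> (\<forall>x\<in>C. g x = h (f x))"
    if "continuous_on UNIV h" for h
  proof -
    have "continuous_map (subtopology X C) euclideanreal (\<lambda>x. h (f x))"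
      by (rule continuous_map_compose_euclidean[OF assms(3) _ that]) simp
    then show ?thesis
      using assms(1,2) normal_space_iff_Tietze by blast
  qed
  obtain a where a: "continuous_map X euclideanreal a" "\<And>x. x \<in> C \<Longrightarrow> a x = Re (f x)"
    using *[of Re] continuous_on_Re[OF continuous_on_id] by auto
  obtain b where b: "continuous_map X euclideanreal b" "\<And>x. x \<in> C \<Longrightarrow> b x = Im (f x)"
    using *[of Im] continuous_on_Im[OF continuous_on_id] by auto
  show ?thesis
  proof
    show "continuous_map X euclidean (\<lambda>x. Complex (a x) (b x))"
      using continuous_map_compose2_euclidean[OF a(1) b(1), of UNIV "\<lambda>(u, v). Complex u v"]
      by (simp add: case_prod_unfold Complex_eq continuous_intros)
  qed (simp add: a(2) b(2) complex_eq_iff)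
qed

context left_fractions
begin

text \<open>The sets shrink as the index grows, so by \<open>upper_boundE\<close> finitely many of
  them always contain another one. If none lay in \<open>U\<close>, the closed sets
  \<open>C h - U\<close> would have the finite intersection property, and a common point would
  contradict the last hypothesis.\<close>

lemma compact_directed_family:
  assumes X: "compact_space X" and C: "\<And>h. h \<in> carrier G \<Longrightarrow> closedin X (C h)"
    and anti: "\<And>h s. h \<in> carrier G \<Longrightarrow> s \<in> carrier S \<Longrightarrow> C h \<subseteq> C (h \<otimes>\<^bsub>G\<^esub> \<iota> s)"
    and U: "openin X U" "(\<Inter>h\<in>carrier G. C h) \<subseteq> U"
  obtains h where "h \<in> carrier G" "C h \<subseteq> U"
proof -
  have bound: "\<exists>h\<in>carrier G. C h \<subseteq> (\<Inter>g\<in>J. C g)" if "finite J" "J \<subseteq> carrier G" for J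
    using that
  proof (induction J)
    case empty
    then show ?case using G.one_closed by auto
  next
    case (insert g J)
    then obtain h where h: "h \<in> carrier G" "C h \<subseteq> (\<Inter>g\<in>J. C g)" by auto
    obtain k s t where k: "k \<in> carrier G" "s \<in> carrier S" "t \<in> carrier S"
      "g = k \<otimes>\<^bsub>G\<^esub> \<iota> s" "h = k \<otimes>\<^bsub>G\<^esub> \<iota> t"
      using upper_boundE[of g h] insert.prems h(1) by auto
    then have "C k \<subseteq> C g" "C k \<subseteq> C h" using anti by auto
    then have "C k \<subseteq> (\<Inter>g\<in>insert g J. C g)" using h(2) by blast
    then show ?case using k(1) by blast
  qed
  have "\<exists>h\<in>carrier G. C h - U = {}"
  proof (rule ccontr)
    assume neg: "\<not> (\<exists>h\<in>carrier G. C h - U = {})"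
    have "\<Inter> ((\<lambda>h. C h - U) ` carrier G) \<noteq> {}"
    proof (rule X[unfolded compact_space_fip, rule_format], intro conjI ballI allI impI)
      fix D assume "D \<in> (\<lambda>h. C h - U) ` carrier G"
      then show "closedin X D" using C U(1) by (auto intro: closedin_diff)
    next
      fix \<F> assume "finite \<F> \<and> \<F> \<subseteq> (\<lambda>h. C h - U) ` carrier G"
      then obtain J where J: "finite J" "J \<subseteq> carrier G" "\<F> = (\<lambda>h. C h - U) ` J"
        by (metis finite_subset_image)
      obtain h where "h \<in> carrier G" "C h \<subseteq> (\<Inter>g\<in>J. C g)" using bound[OF J(1,2)] by blast
      then have "C h - U \<noteq> {}" "C h - U \<subseteq> \<Inter> \<F>" using neg J(3) by auto
      then show "\<Inter> \<F> \<noteq> {}" by blast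
    qed
    then obtain x where x: "\<And>h. h \<in> carrier G \<Longrightarrow> x \<in> C h - U" by blast
    then have "x \<in> (\<Inter>h\<in>carrier G. C h)" "x \<notin> U" using G.one_closed by auto
    then show False using U(2) by blast
  qed
  then show ?thesis using that by blast
qed

end

locale compact_ore_right_action = ore_right_action S G \<iota> K \<rho>
  for S :: "('s, 'm) monoid_scheme" and G :: "('g, 'n) monoid_scheme" and \<iota> :: "'s \<Rightarrow> 'g"
    and K :: "'k top_group" and \<rho> :: "'s \<Rightarrow> 'k \<Rightarrow> 'k" +
  assumes compact_ab_group: "compact_ab_group K"
begin

lemma topological_ab_group: "topological_ab_group K"
  and compact_K: "compact_space (tp K)" and Hausdorff_K: "Hausdorff_space (tp K)"
  using compact_ab_group by (simp_all add: compact_ab_group_def)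

sublocale K: comm_group K
  using topological_ab_group by (simp add: topological_ab_group_def)

lemma topspace_K [simp]: "topspace (tp K) = carrier K"
  using topological_ab_group by (simp add: topological_ab_group_def)

lemma \<rho>_one [simp]: "s \<in> carrier S \<Longrightarrow> \<rho> s \<one>\<^bsub>K\<^esub> = \<one>\<^bsub>K\<^esub>"
  using \<rho>_mult[of s "\<one>\<^bsub>K\<^esub>" "\<one>\<^bsub>K\<^esub>"] by (simp add: K.l_cancel_one')

lemma left_action_dual: "left_action S (dual K) (dual_action K \<rho>)"
  unfolding left_action_def
proof (intro conjI ballI)
  fix s assume s: "s \<in> carrier S"
  have "dual_action K \<rho> s \<xi> \<in> characters K" if \<xi>: "\<xi> \<in> characters K" for \<xi>
  proof -
    have "continuous_map (tp K) euclidean (\<xi> \<circ> \<rho> s)"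
      using \<xi> \<rho>_continuous[OF s] by (intro continuous_map_compose) (auto simp: in_characters_iff)
    then have "continuous_map (tp K) euclidean (dual_action K \<rho> s \<xi>)"
      by (rule continuous_map_eq) (simp add: dual_action_def compose_def)
    then show ?thesis
      using \<xi> s by (auto simp: in_characters_iff dual_action_def compose_def \<rho>_mult)
  qed
  then show "dual_action K \<rho> s \<in> hom (dual K) (dual K)"
    using s by (auto simp: hom_def dual_action_def compose_def cong: restrict_cong)
next
  fix \<xi> assume \<xi>: "\<xi> \<in> carrier (dual K)"
  then show "dual_action K \<rho> \<one>\<^bsub>S\<^esub> \<xi> = \<xi>"
    by (auto simp: dual_action_def compose_def in_characters_iff \<rho>_S_one extensional_restrict cong: restrict_cong)
  fix s t assume "s \<in> carrier S" "t \<in> carrier S"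
  then show "dual_action K \<rho> (s \<otimes>\<^bsub>S\<^esub> t) \<xi> = dual_action K \<rho> s (dual_action K \<rho> t \<xi>)"
    by (auto simp: dual_action_def compose_def \<rho>_S_mult cong: restrict_cong)
qed

sublocale L: ore_left_action S G \<iota> "dual K" "dual_action K \<rho>"
  using comm_group_dual[OF topological_ab_group] left_action_dual
  by (intro ore_left_action.intro ore_left_action_axioms.intro left_fractions_axioms)

section \<open>The ambient power of \<open>K\<close> and the families compatible at one
  index\<close>

definition product_space where "product_space = product_topology (\<lambda>g. tp K) (carrier G)"

lemma topspace_product_space [simp]: "topspace product_space = carrier G \<rightarrow>\<^sub>E carrier K"
  by (simp add: product_space_def)

lemma compact_product_space: "compact_space product_space"
  unfolding product_space_def by (simp add: compact_space_product_topology compact_K)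

lemma Hausdorff_product_space: "Hausdorff_space product_space"
  unfolding product_space_def by (simp add: Hausdorff_space_product_topology Hausdorff_K)

lemma continuous_map_product_space_eval: "g \<in> carrier G \<Longrightarrow> continuous_map product_space (tp K) (\<lambda>k. k g)"
  unfolding product_space_def by (rule continuous_map_product_projection)

definition compatible_families where
  "compatible_families h = {k \<in> topspace product_space. compatible h k}"

lemma closedin_compatible_families:
  assumes "h \<in> carrier G"
  shows "closedin product_space (compatible_families h)"
proof -
  have "closedin product_space {k \<in> topspace product_space. k (h \<otimes>\<^bsub>G\<^esub> \<iota> s) = \<rho> s (k h)}" if s: "s \<in> carrier S" for s
  proof (rule closedin_continuous_maps_eq[OF Hausdorff_K])
    show "continuous_map product_space (tp K) (\<lambda>k. k (h \<otimes>\<^bsub>G\<^esub> \<iota> s))"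
      using assms s by (intro continuous_map_product_space_eval) auto
    show "continuous_map product_space (tp K) (\<lambda>k. \<rho> s (k h))"
      using continuous_map_compose[OF continuous_map_product_space_eval[OF assms] \<rho>_continuous[OF s]] by (simp add: o_def)
  qed
  then have "closedin product_space (\<Inter>s\<in>carrier S. {k \<in> topspace product_space. k (h \<otimes>\<^bsub>G\<^esub> \<iota> s) = \<rho> s (k h)})"
    using S.one_closed by (intro closedin_INT) auto
  moreover have "(\<Inter>s\<in>carrier S. {k \<in> topspace product_space. k (h \<otimes>\<^bsub>G\<^esub> \<iota> s) = \<rho> s (k h)}) = compatible_families h"
    using S.one_closed by (auto simp: compatible_families_def compatible_def)
  ultimately show ?thesis by simp
qed

text \<open>By \<open>\<rho>_S_mult\<close>, passing from \<open>h\<close> to \<open>h s t\<close>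
  in one step or through \<open>h s\<close> gives the same result, so compatibility at
  \<open>h\<close> entails compatibility at every lower index.\<close>

lemma compatible_families_anti:
  assumes "h \<in> carrier G" "s \<in> carrier S"
  shows "compatible_families h \<subseteq> compatible_families (h \<otimes>\<^bsub>G\<^esub> \<iota> s)"
proof
  fix k assume k: "k \<in> compatible_families h"
  then have "k h \<in> carrier K" using assms by (auto simp: compatible_families_def)
  then show "k \<in> compatible_families (h \<otimes>\<^bsub>G\<^esub> \<iota> s)"
    using k assms by (auto simp: compatible_families_def compatible_def mult_\<iota>_mult \<rho>_S_mult)
qed

lemma carrier_Kstar_Inter: "carrier Kstar = (\<Inter>h\<in>carrier G. compatible_families h)"
  using G.one_closed by (auto simp: carrier_colocalization compatible_families_def)

lemma Kstar_subset: "h \<in> carrier G \<Longrightarrow> carrier Kstar \<subseteq> compatible_families h"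
  by (auto simp: carrier_Kstar_Inter)

lemma closedin_Kstar: "closedin product_space (carrier Kstar)"
  unfolding carrier_Kstar_Inter using G.one_closed closedin_compatible_families
  by (intro closedin_INT) auto

lemma tp_Kstar: "tp Kstar = subtopology product_space (carrier Kstar)"
  by (simp add: tp_colocalization product_space_def)

lemma topspace_Kstar [simp]: "topspace (tp Kstar) = carrier Kstar"
  using closedin_subset[OF closedin_Kstar] by (auto simp: tp_Kstar)

lemma compact_Kstar: "compact_space (tp Kstar)"
  unfolding tp_Kstar using compact_product_space closedin_Kstar closedin_compact_space compact_space_subtopology
  by blast

lemma monoid_Kstar: "monoid Kstar"
proof (rule monoidI)
  have one: "\<one>\<^bsub>Kstar\<^esub> = (\<lambda>g\<in>carrier G. \<one>\<^bsub>K\<^esub>)"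
    by (simp add: ore_colocalization_def inverse_limit_def core_group_def Let_def)
  show "\<one>\<^bsub>Kstar\<^esub> \<in> carrier Kstar"
    by (auto simp: one carrier_colocalization compatible_def)
  fix k assume k: "k \<in> carrier Kstar"
  then have kc: "\<And>g. g \<in> carrier G \<Longrightarrow> k g \<in> carrier K" and ext: "k \<in> extensional (carrier G)"
    by (auto simp: carrier_colocalization PiE_iff)
  show "\<one>\<^bsub>Kstar\<^esub> \<otimes>\<^bsub>Kstar\<^esub> k = k" "k \<otimes>\<^bsub>Kstar\<^esub> \<one>\<^bsub>Kstar\<^esub> = k"
    using kc ext by (simp_all add: one extensional_restrict cong: restrict_cong)
  fix l assume l: "l \<in> carrier Kstar"
  then have lc: "\<And>g. g \<in> carrier G \<Longrightarrow> l g \<in> carrier K"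
    by (auto simp: carrier_colocalization)
  show "k \<otimes>\<^bsub>Kstar\<^esub> l \<in> carrier Kstar"
    using k l by (auto simp: carrier_colocalization compatible_def \<rho>_mult kc lc)
  fix m assume "m \<in> carrier Kstar"
  then have "\<And>g. g \<in> carrier G \<Longrightarrow> m g \<in> carrier K"
    by (auto simp: carrier_colocalization)
  then show "k \<otimes>\<^bsub>Kstar\<^esub> l \<otimes>\<^bsub>Kstar\<^esub> m = k \<otimes>\<^bsub>Kstar\<^esub> (l \<otimes>\<^bsub>Kstar\<^esub> m)"
    by (simp add: K.m_assoc kc lc cong: restrict_cong)
qed

text \<open>Stands in for a compatible family with component \<open>x\<close> at \<open>h\<close>, which need not exist.\<close>

definition partial_family where
  "partial_family h x = (\<lambda>g\<in>carrier G.
     if fraction_le S G \<iota> g h then \<rho> (fraction_quotient S G \<iota> g h) x else \<one>\<^bsub>K\<^esub>)"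

lemma partial_family_cases:
  assumes "h \<in> carrier G" "g \<in> carrier G"
  obtains s where "s \<in> carrier S" "\<And>x. partial_family h x g = \<rho> s x" "g = h \<otimes>\<^bsub>G\<^esub> \<iota> s"
  | "\<And>x. partial_family h x g = \<one>\<^bsub>K\<^esub>"
proof (cases "fraction_le S G \<iota> g h")
  case True
  then obtain s where "s \<in> carrier S" "g = h \<otimes>\<^bsub>G\<^esub> \<iota> s"
    using assms fraction_le_iff by blast
  then show ?thesis
    using that(1)[of s] assms True by (simp add: partial_family_def)
next
  case False
  then show ?thesis using that(2) assms by (simp add: partial_family_def)
qed

lemma partial_family_mult_\<iota>:
  assumes "h \<in> carrier G" "s \<in> carrier S"
  shows "partial_family h x (h \<otimes>\<^bsub>G\<^esub> \<iota> s) = \<rho> s x"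
proof -
  have "fraction_le S G \<iota> (h \<otimes>\<^bsub>G\<^esub> \<iota> s) h"
    using assms by (subst fraction_le_iff) auto
  then show ?thesis using assms by (simp add: partial_family_def)
qed

lemma partial_family_closed:
  assumes "h \<in> carrier G" "x \<in> carrier K"
  shows "partial_family h x \<in> topspace product_space"
proof -
  have "partial_family h x g \<in> carrier K" if "g \<in> carrier G" for g
    using partial_family_cases[OF assms(1) that] assms(2) by (metis K.one_closed \<rho>_closed)
  then show ?thesis by (auto simp: partial_family_def)
qed

lemma partial_family_compatible:
  assumes "h \<in> carrier G" "x \<in> carrier K"
  shows "partial_family h x \<in> compatible_families h"
proof -
  have "partial_family h x h = x"
    using partial_family_mult_\<iota>[OF assms(1) S.one_closed, of x] assms by (simp add: \<rho>_S_one)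
  then have "compatible h (partial_family h x)"
    unfolding compatible_def using partial_family_mult_\<iota>[OF assms(1)] by simp
  then show ?thesis
    using partial_family_closed[OF assms] by (simp only: compatible_families_def mem_Collect_eq simp_thms)
qed

text \<open>At indices that are not below \<open>h\<close> this holds because the default value is
  the unit.\<close>

lemma partial_family_mult:
  assumes "h \<in> carrier G" "x \<in> carrier K" "y \<in> carrier K"
  shows "partial_family h (x \<otimes>\<^bsub>K\<^esub> y) =
    (\<lambda>g\<in>carrier G. partial_family h x g \<otimes>\<^bsub>K\<^esub> partial_family h y g)" (is "?l = ?r")
proof (rule extensionalityI[of _ "carrier G"])
  fix g assume g: "g \<in> carrier G"
  show "?l g = ?r g"
    using assms g by (cases rule: partial_family_cases[OF assms(1) g]) (simp_all add: \<rho>_mult)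
qed (simp_all add: partial_family_def)

lemma continuous_map_partial_family:
  assumes "h \<in> carrier G"
  shows "continuous_map (tp K) product_space (partial_family h)"
  unfolding product_space_def continuous_map_componentwise
proof (intro conjI ballI)
  show "partial_family h ` topspace (tp K) \<subseteq> extensional (carrier G)"
    by (auto simp: partial_family_def)
  fix g assume g: "g \<in> carrier G"
  show "continuous_map (tp K) (tp K) (\<lambda>x. partial_family h x g)"
    using assms g by (cases rule: partial_family_cases[OF assms g]) (simp_all add: \<rho>_continuous)
qed

section \<open>Characters of the inverse limit that depend on one component\<close>

definition component_character where "component_character g \<zeta> = (\<lambda>k\<in>carrier Kstar. \<zeta> (k g))"

text \<open>Counterpart of \<open>germ_lam\<close>: component characters and germs change their
  index by the same rule.\<close>

lemma component_character_lam:
  assumes "k \<in> carrier G" "s \<in> carrier S"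
  shows "component_character (k \<otimes>\<^bsub>G\<^esub> \<iota> s) \<zeta> = component_character k (dual_action K \<rho> s \<zeta>)"
  unfolding component_character_def dual_action_def compose_def using assms
  by (intro restrict_ext) (auto simp: carrier_colocalization compatible_def)

lemma continuous_map_eval_character:
  assumes "g \<in> carrier G" "\<zeta> \<in> characters K"
  shows "continuous_map product_space euclidean (\<lambda>k. \<zeta> (k g))"
  using continuous_map_compose[OF continuous_map_product_space_eval[OF assms(1)], of euclidean \<zeta>] assms(2)
  by (simp add: o_def in_characters_iff)

lemma component_character_closed:
  assumes "g \<in> carrier G" "\<zeta> \<in> characters K"
  shows "component_character g \<zeta> \<in> characters Kstar"
proof -
  have "continuous_map (tp Kstar) euclidean (component_character g \<zeta>)"
  proof (rule continuous_map_eq)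
    show "continuous_map (tp Kstar) euclidean (\<lambda>k. \<zeta> (k g))"
      unfolding tp_Kstar by (intro continuous_map_from_subtopology continuous_map_eval_character assms)
  qed (simp add: component_character_def)
  moreover have "k g \<in> carrier K" if "k \<in> carrier Kstar" for k
    using that assms(1) by (auto simp: carrier_colocalization)
  moreover have "k \<otimes>\<^bsub>Kstar\<^esub> l \<in> carrier Kstar" if "k \<in> carrier Kstar" "l \<in> carrier Kstar" for k l
    using monoid.m_closed[OF monoid_Kstar that] .
  ultimately show ?thesis
    using assms by (auto simp: in_characters_iff component_character_def)
qed

text \<open>The hypothesis compares \<open>\<zeta>\<close> and \<open>\<zeta>'\<close> only at
  components of members of \<open>K*\<close>. The open condition that they differ by less than
  \<open>1\<close> at the component \<open>m\<close> extends to all families compatible at some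
  \<open>h\<close>. Above \<open>m\<close> and \<open>h\<close> there is an index \<open>k\<close>
  at which the component can be any \<open>y\<close> in \<open>K\<close>, so the characters become
  uniformly close, hence equal, after the action of \<open>s\<close>.\<close>

lemma component_character_eq_imp_germ_eq_same_index:
  assumes m: "m \<in> carrier G" and \<zeta>: "\<zeta> \<in> characters K" "\<zeta>' \<in> characters K" and eq: "component_character m \<zeta> = component_character m \<zeta>'"
  shows "L.germ m \<zeta> = L.germ m \<zeta>'"
proof -
  define U where "U = {k \<in> topspace product_space. (\<zeta> (k m), \<zeta>' (k m)) \<in> {(u, v). norm (u - v) < 1}}"
  have "openin product_space U" unfolding U_def
  proof (rule openin_continuous_map_preimage)
    show "continuous_map product_space euclidean (\<lambda>k. (\<zeta> (k m), \<zeta>' (k m)))"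
      using continuous_map_pairedI[OF continuous_map_eval_character[OF m \<zeta>(1)] continuous_map_eval_character[OF m \<zeta>(2)]]
      by (simp add: euclidean_product_topology)
    show "openin euclidean {(u :: complex, v). norm (u - v) < 1}"
      unfolding case_prod_unfold open_openin[symmetric] by (intro open_Collect_less continuous_intros)
  qed
  moreover have "(\<Inter>h\<in>carrier G. compatible_families h) \<subseteq> U"
    unfolding carrier_Kstar_Inter[symmetric]
  proof
    fix k assume k: "k \<in> carrier Kstar"
    then have "\<zeta> (k m) = \<zeta>' (k m)" using fun_cong[OF eq, of k] by (simp add: component_character_def)
    then show "k \<in> U" using k Kstar_subset[OF m] by (auto simp: U_def compatible_families_def)
  qed
  ultimately obtain h where h: "h \<in> carrier G" "compatible_families h \<subseteq> U"
    using compact_directed_family[OF compact_product_space closedin_compatible_families compatible_families_anti] by blast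
  obtain k s t where k: "k \<in> carrier G" "s \<in> carrier S" "t \<in> carrier S"
    "m = k \<otimes>\<^bsub>G\<^esub> \<iota> s" "h = k \<otimes>\<^bsub>G\<^esub> \<iota> t"
    using upper_boundE[OF m h(1)] .
  have da: "dual_action K \<rho> s \<zeta> \<in> characters K" "dual_action K \<rho> s \<zeta>' \<in> characters K"
    using L.lam_closed[OF k(2)] \<zeta> by auto
  have "dual_action K \<rho> s \<zeta> x = dual_action K \<rho> s \<zeta>' x" if "x \<in> carrier K" for x
  proof (rule close_hom_circle_eq[OF K.monoid_axioms _ _ that])
    show "dual_action K \<rho> s \<zeta> \<in> hom K circle" "dual_action K \<rho> s \<zeta>' \<in> hom K circle"
      using da by (auto simp: characters_def)
    fix y assume y: "y \<in> carrier K"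
    \<comment> \<open>This family is compatible at \<open>k\<close>, hence at the lower index
      \<open>h\<close>; its component at \<open>m = k s\<close> is
      \<open>\<rho> s y\<close>.\<close>
    have "partial_family k y \<in> U"
      using partial_family_compatible[OF k(1) y] compatible_families_anti[OF k(1,3)] h(2) k(5) by blast
    then show "norm (dual_action K \<rho> s \<zeta> y - dual_action K \<rho> s \<zeta>' y) < 1"
      using y partial_family_mult_\<iota>[OF k(1,2)] by (simp add: U_def dual_action_def compose_def k(4))
  qed
  moreover have "dual_action K \<rho> s \<zeta> \<in> extensional (carrier K)" "dual_action K \<rho> s \<zeta>' \<in> extensional (carrier K)"
    by (simp_all add: dual_action_def)
  ultimately have "dual_action K \<rho> s \<zeta> = dual_action K \<rho> s \<zeta>'"
    by (intro extensionalityI[of _ "carrier K"]) auto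
  then show ?thesis
    using L.germ_lam[OF k(1,2)] \<zeta> by (simp add: k(4))
qed

lemma component_character_eq_imp_germ_eq:
  assumes "g \<in> carrier G" "h \<in> carrier G" "\<zeta> \<in> characters K" "\<zeta>' \<in> characters K"
    and eq: "component_character g \<zeta> = component_character h \<zeta>'"
  shows "L.germ g \<zeta> = L.germ h \<zeta>'"
proof -
  obtain m s t where m: "m \<in> carrier G" "s \<in> carrier S" "t \<in> carrier S"
    "g = m \<otimes>\<^bsub>G\<^esub> \<iota> s" "h = m \<otimes>\<^bsub>G\<^esub> \<iota> t"
    using upper_boundE[OF assms(1,2)] .
  have da: "dual_action K \<rho> s \<zeta> \<in> characters K" "dual_action K \<rho> t \<zeta>' \<in> characters K"
    using L.lam_closed[OF m(2)] L.lam_closed[OF m(3)] assms(3,4) by auto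
  have "component_character m (dual_action K \<rho> s \<zeta>) = component_character m (dual_action K \<rho> t \<zeta>')"
    using eq m by (simp add: component_character_lam)
  then show ?thesis
    using component_character_eq_imp_germ_eq_same_index[OF m(1) da] L.germ_lam[OF m(1)] m(2-5) assms(3,4) by simp
qed

lemma germ_eq_imp_component_character_eq:
  assumes "g \<in> carrier G" "h \<in> carrier G" "\<zeta> \<in> characters K" "\<zeta>' \<in> characters K"
    and eq: "L.germ g \<zeta> = L.germ h \<zeta>'"
  shows "component_character g \<zeta> = component_character h \<zeta>'"
proof -
  obtain m s t where m: "m \<in> carrier G" "s \<in> carrier S" "t \<in> carrier S"
    "g = m \<otimes>\<^bsub>G\<^esub> \<iota> s" "h = m \<otimes>\<^bsub>G\<^esub> \<iota> t" "dual_action K \<rho> s \<zeta> = dual_action K \<rho> t \<zeta>'"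
    using L.germ_eq_iff[of g h \<zeta> \<zeta>'] assms by auto
  then show ?thesis by (simp add: component_character_lam)
qed

text \<open>Near \<open>K*\<close>, an extension \<open>f\<close> of \<open>\<xi>\<close> to the
  ambient space is almost multiplicative and almost determined by the components below some index.
  At an \<open>h\<close> that is large enough for both, \<open>f (partial_family h x)\<close> is an
  almost multiplicative function of \<open>x\<close> in \<open>K\<close>, and the character close to
  it induces \<open>\<xi>\<close>.\<close>

lemma component_character_surj:
  assumes \<xi>: "\<xi> \<in> characters Kstar"
  obtains g \<zeta> where "g \<in> carrier G" "\<zeta> \<in> characters K" "\<xi> = component_character g \<zeta>"
proof -
  have "continuous_map (subtopology product_space (carrier Kstar)) euclidean \<xi>"
    using \<xi> by (simp add: in_characters_iff flip: tp_Kstar)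
  moreover have "normal_space product_space"
    using compact_product_space Hausdorff_product_space compact_Hausdorff_or_regular_imp_normal_space by blast
  ultimately obtain f where f: "continuous_map product_space euclidean f" and f\<xi>: "\<And>k. k \<in> carrier Kstar \<Longrightarrow> f k = \<xi> k"
    using Tietze_extension_complex[OF _ closedin_Kstar] by metis
  let ?PP = "prod_topology product_space product_space"
  have compact_PP: "compact_space ?PP" using compact_product_space by (simp add: compact_space_prod_topology)
  \<comment> \<open>Coordinatewise multiplication on the whole ambient space, since multiplicativity
    must be expressed for families outside \<open>K*\<close> as well.\<close>
  define mul where "mul = (\<lambda>(k, l). \<lambda>g\<in>carrier G. k g \<otimes>\<^bsub>K\<^esub> l g)"
  have mul: "continuous_map ?PP product_space mul"
    unfolding product_space_def continuous_map_componentwise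
  proof (intro conjI ballI, fold product_space_def)
    show "mul ` topspace ?PP \<subseteq> extensional (carrier G)" by (auto simp: mul_def)
    fix g assume g: "g \<in> carrier G"
    have "continuous_map ?PP (tp K) ((\<lambda>k. k g) \<circ> fst)" "continuous_map ?PP (tp K) ((\<lambda>k. k g) \<circ> snd)"
      by (rule continuous_map_compose[OF _ continuous_map_product_space_eval[OF g]], rule continuous_map_fst continuous_map_snd)+
    then have "continuous_map ?PP (tp K) ((\<lambda>(x, y). x \<otimes>\<^bsub>K\<^esub> y) \<circ> (\<lambda>p. (fst p g, snd p g)))"
      using topological_ab_group unfolding topological_ab_group_def
      by (intro continuous_map_compose[where X' = "prod_topology (tp K) (tp K)"] continuous_map_pairedI) (simp_all add: o_def)
    then show "continuous_map ?PP (tp K) (\<lambda>p. mul p g)"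
      by (rule continuous_map_eq) (use g in \<open>auto simp: mul_def\<close>)
  qed
  have c1: "continuous_map ?PP euclidean (\<lambda>p. f (fst p))" and c2: "continuous_map ?PP euclidean (\<lambda>p. f (snd p))"
    and c3: "continuous_map ?PP euclidean (\<lambda>p. f (mul p))"
    using continuous_map_compose[OF continuous_map_fst f] continuous_map_compose[OF continuous_map_snd f]
      continuous_map_compose[OF mul f] by (simp_all add: o_def)
  have c123: "continuous_map ?PP euclidean (\<lambda>p. (f (fst p), f (snd p), f (mul p)))"
    using continuous_map_pairedI[OF c1 continuous_map_pairedI[OF c2 c3]] by (simp add: euclidean_product_topology)
  \<comment> \<open>The two conditions are the hypotheses of \<open>approximate_character\<close>.
    On pairs from \<open>K*\<close> they hold strictly, because there \<open>f\<close> is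
    multiplicative with values of norm \<open>1\<close>.\<close>
  define U where "U = {p \<in> topspace ?PP. (f (fst p), f (snd p), f (mul p)) \<in>
    {(u, v, w). norm (w - u * v) < norm (u * v) / 16} \<inter> {(u, v, w). norm u < 2}}"
  \<comment> \<open>The bound \<open>2/5\<close> is what the error \<open>3/5\<close> of
    \<open>approximate_character\<close> leaves of the total \<open>1\<close>.\<close>
  define V where "V = {p \<in> topspace ?PP. (f (fst p), f (snd p), f (mul p)) \<in> {(u, v, w). norm (u - v) < 2/5}}"
  have U: "openin ?PP U"
    unfolding U_def
  proof (rule openin_continuous_map_preimage[OF c123])
    show "openin euclidean ({(u :: complex, v, w). norm (w - u * v) < norm (u * v) / 16} \<inter> {(u, v, w). norm u < 2})"
      unfolding case_prod_unfold open_openin[symmetric] by (intro open_Int open_Collect_less continuous_intros) auto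
  qed
  have V: "openin ?PP V"
    unfolding V_def
  proof (rule openin_continuous_map_preimage[OF c123])
    show "openin euclidean {(u :: complex, v, w :: complex). norm (u - v) < 2/5}"
      unfolding case_prod_unfold open_openin[symmetric] by (intro open_Collect_less continuous_intros)
  qed
  obtain h1 where h1: "h1 \<in> carrier G" "compatible_families h1 \<times> compatible_families h1 \<subseteq> U"
  proof (rule compact_directed_family[OF compact_PP _ _ U, where C = "\<lambda>h. compatible_families h \<times> compatible_families h"])
    show "(\<Inter>h\<in>carrier G. compatible_families h \<times> compatible_families h) \<subseteq> U"
    proof
      fix p assume "p \<in> (\<Inter>h\<in>carrier G. compatible_families h \<times> compatible_families h)"
      then have p: "fst p \<in> carrier Kstar" "snd p \<in> carrier Kstar"
        by (auto simp: carrier_Kstar_Inter)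
      then have m: "mul p = fst p \<otimes>\<^bsub>Kstar\<^esub> snd p" "mul p \<in> carrier Kstar"
        using monoid.m_closed[OF monoid_Kstar p] by (auto simp: mul_def case_prod_unfold)
      have "p \<in> topspace ?PP"
        using p Kstar_subset[OF G.one_closed] by (auto simp: mem_Times_iff compatible_families_def)
      moreover have "f (mul p) = f (fst p) * f (snd p)" "norm (f (fst p)) = 1" "norm (f (snd p)) = 1"
        using \<xi> p m by (simp_all add: f\<xi> in_characters_iff del: mult_colocalization)
      ultimately show "p \<in> U" by (simp add: U_def norm_mult)
    qed
  next
    fix h assume h: "h \<in> carrier G"
    then show "closedin ?PP (compatible_families h \<times> compatible_families h)"
      by (simp add: closedin_prod_Times_iff closedin_compatible_families)
    fix s assume "s \<in> carrier S"
    then show "compatible_families h \<times> compatible_families h \<subseteq>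
        compatible_families (h \<otimes>\<^bsub>G\<^esub> \<iota> s) \<times> compatible_families (h \<otimes>\<^bsub>G\<^esub> \<iota> s)"
      using h by (intro Sigma_mono compatible_families_anti)
  qed
  \<comment> \<open>Pairs of families with the same components at all indices below
    \<open>h\<close>. The intersection over all \<open>h\<close> is the diagonal, which lies in
    \<open>V\<close>; by compactness the components below a single \<open>h2\<close> already
    determine \<open>f\<close> up to \<open>2/5\<close>.\<close>
  define agree where "agree = (\<lambda>h. {p \<in> topspace ?PP. \<forall>s\<in>carrier S. fst p (h \<otimes>\<^bsub>G\<^esub> \<iota> s) = snd p (h \<otimes>\<^bsub>G\<^esub> \<iota> s)})"
  obtain h2 where h2: "h2 \<in> carrier G" "agree h2 \<subseteq> V"
  proof (rule compact_directed_family[OF compact_PP _ _ V, where C = agree])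
    fix h assume h: "h \<in> carrier G"
    have "closedin ?PP {p \<in> topspace ?PP. fst p (h \<otimes>\<^bsub>G\<^esub> \<iota> s) = snd p (h \<otimes>\<^bsub>G\<^esub> \<iota> s)}" if "s \<in> carrier S" for s
    proof -
      have hs: "h \<otimes>\<^bsub>G\<^esub> \<iota> s \<in> carrier G" using h that by auto
      show ?thesis
        using continuous_map_compose[OF continuous_map_fst continuous_map_product_space_eval[OF hs]]
          continuous_map_compose[OF continuous_map_snd continuous_map_product_space_eval[OF hs]]
        by (intro closedin_continuous_maps_eq[OF Hausdorff_K]) (simp_all add: o_def)
    qed
    then have "closedin ?PP (\<Inter>s\<in>carrier S. {p \<in> topspace ?PP. fst p (h \<otimes>\<^bsub>G\<^esub> \<iota> s) = snd p (h \<otimes>\<^bsub>G\<^esub> \<iota> s)})"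
      using S.one_closed by (intro closedin_INT) auto
    moreover have "(\<Inter>s\<in>carrier S. {p \<in> topspace ?PP. fst p (h \<otimes>\<^bsub>G\<^esub> \<iota> s) = snd p (h \<otimes>\<^bsub>G\<^esub> \<iota> s)}) = agree h"
      using S.one_closed by (auto simp: agree_def)
    ultimately show "closedin ?PP (agree h)" by simp
    fix s assume "s \<in> carrier S"
    then show "agree h \<subseteq> agree (h \<otimes>\<^bsub>G\<^esub> \<iota> s)"
      using h by (auto simp: agree_def mult_\<iota>_mult)
  next
    show "(\<Inter>h\<in>carrier G. agree h) \<subseteq> V"
    proof
      fix p assume p: "p \<in> (\<Inter>h\<in>carrier G. agree h)"
      then have top: "p \<in> topspace ?PP" using G.one_closed by (auto simp: agree_def)
      have "fst p g = snd p g" if "g \<in> carrier G" for g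
      proof -
        have "fst p (g \<otimes>\<^bsub>G\<^esub> \<iota> \<one>\<^bsub>S\<^esub>) = snd p (g \<otimes>\<^bsub>G\<^esub> \<iota> \<one>\<^bsub>S\<^esub>)"
          using p that S.one_closed unfolding agree_def by blast
        then show ?thesis using that by simp
      qed
      then have "fst p = snd p"
        using top by (intro PiE_ext[of _ "carrier G" "\<lambda>_. carrier K"]) (auto simp: mem_Times_iff)
      then show "p \<in> V" using top by (simp add: V_def)
    qed
  qed
  \<comment> \<open>Both conclusions hold at any index above \<open>h1\<close> and
    \<open>h2\<close>.\<close>
  obtain h s t where h: "h \<in> carrier G" "s \<in> carrier S" "t \<in> carrier S"
    "h1 = h \<otimes>\<^bsub>G\<^esub> \<iota> s" "h2 = h \<otimes>\<^bsub>G\<^esub> \<iota> t"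
    using upper_boundE[OF h1(1) h2(1)] .
  define F where "F = (\<lambda>x. f (partial_family h x))"
  have pairU: "(partial_family h x, partial_family h y) \<in> U" if "x \<in> carrier K" "y \<in> carrier K" for x y
    using that partial_family_compatible[OF h(1)] compatible_families_anti[OF h(1,2)] h1(2) h(4) by blast
  obtain \<zeta> where \<zeta>: "\<zeta> \<in> characters K" "\<And>x. x \<in> carrier K \<Longrightarrow> norm (\<zeta> x - F x) < 3/5"
  proof (rule approximate_character[OF topological_ab_group])
    show "continuous_map (tp K) euclidean F"
      using continuous_map_compose[OF continuous_map_partial_family[OF h(1)] f] by (simp add: F_def o_def)
    fix x assume x: "x \<in> carrier K"
    show "norm (F x) < 2"
      using pairU[OF x x] by (simp add: U_def F_def)
    fix y assume y: "y \<in> carrier K"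
    have "mul (partial_family h x, partial_family h y) = partial_family h (x \<otimes>\<^bsub>K\<^esub> y)"
      by (simp add: mul_def partial_family_mult[OF h(1) x y])
    then show "norm (F (x \<otimes>\<^bsub>K\<^esub> y) - F x * F y) < norm (F x * F y) / 16"
      using pairU[OF x y] by (simp add: U_def F_def)
  qed (rule that)
  have component_character: "component_character h \<zeta> \<in> characters Kstar" by (rule component_character_closed[OF h(1) \<zeta>(1)])
  have "\<xi> k = component_character h \<zeta> k" if k: "k \<in> carrier Kstar" for k
  proof (rule close_hom_circle_eq[OF monoid_Kstar _ _ k])
    show "\<xi> \<in> hom Kstar circle" "component_character h \<zeta> \<in> hom Kstar circle"
      using \<xi> component_character by (auto simp: characters_def)
    fix l assume l: "l \<in> carrier Kstar"
    have lh: "l h \<in> carrier K" and comp: "compatible h l" and ltop: "l \<in> topspace product_space"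
      using l h(1) by (auto simp: carrier_colocalization)
    \<comment> \<open>Since \<open>l\<close> is compatible at \<open>h\<close>, its components below
      \<open>h\<close> are generated by \<open>l h\<close>. Thus \<open>l\<close> agrees with the
      partial family at all indices below \<open>h2\<close>, though possibly not elsewhere.\<close>
    have "partial_family h (l h) (h2 \<otimes>\<^bsub>G\<^esub> \<iota> u) = l (h2 \<otimes>\<^bsub>G\<^esub> \<iota> u)" if u: "u \<in> carrier S" for u
      using comp partial_family_mult_\<iota>[OF h(1)] h(1,3) u by (simp add: h(5) mult_\<iota>_mult compatible_def)
    then have "(partial_family h (l h), l) \<in> agree h2"
      using partial_family_closed[OF h(1) lh] ltop by (simp add: agree_def)
    then have "norm (F (l h) - \<xi> l) < 2/5"
      using h2(2) l by (auto simp: V_def F_def f\<xi>)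
    moreover have "norm (component_character h \<zeta> l - F (l h)) < 3/5"
      using \<zeta>(2)[OF lh] l by (simp add: component_character_def)
    ultimately have "norm (\<xi> l - F (l h)) + norm (F (l h) - component_character h \<zeta> l) < 1"
      by (simp add: norm_minus_commute)
    then show "norm (\<xi> l - component_character h \<zeta> l) < 1"
      using norm_triangle_ineq[of "\<xi> l - F (l h)" "F (l h) - component_character h \<zeta> l"] by simp
  qed
  moreover have "\<xi> \<in> extensional (carrier Kstar)" "component_character h \<zeta> \<in> extensional (carrier Kstar)"
    using \<xi> component_character by (auto simp: in_characters_iff)
  ultimately have "\<xi> = component_character h \<zeta>" by (intro extensionalityI[of _ "carrier Kstar"]) auto
  then show ?thesis using that h(1) \<zeta>(1) by blast
qed

text \<open>For a character of \<open>Kstar\<close> the chosen pair exists by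
  \<open>component_character_surj\<close>, and its germ is independent of the choice by
  \<open>component_character_eq_imp_germ_eq\<close>.\<close>

definition to_germ where
  "to_germ \<xi> = (case (SOME (g, \<zeta>). g \<in> carrier G \<and> \<zeta> \<in> characters K \<and> \<xi> = component_character g \<zeta>) of (g, \<zeta>) \<Rightarrow> L.germ g \<zeta>)"

lemma to_germ_component_character:
  assumes g: "g \<in> carrier G" "\<zeta> \<in> characters K"
  shows "to_germ (component_character g \<zeta>) = L.germ g \<zeta>"
proof -
  define p where "p = (SOME (h, \<zeta>'). h \<in> carrier G \<and> \<zeta>' \<in> characters K \<and> component_character g \<zeta> = component_character h \<zeta>')"
  have "case p of (h, \<zeta>') \<Rightarrow> h \<in> carrier G \<and> \<zeta>' \<in> characters K \<and> component_character g \<zeta> = component_character h \<zeta>'"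
    unfolding p_def by (rule someI[of _ "(g, \<zeta>)"]) (use g in auto)
  moreover obtain h \<zeta>' where p: "p = (h, \<zeta>')" by (cases p)
  ultimately have "L.germ g \<zeta> = L.germ h \<zeta>'"
    using g by (intro component_character_eq_imp_germ_eq) simp_all
  moreover have "to_germ (component_character g \<zeta>) = (case p of (h, \<zeta>') \<Rightarrow> L.germ h \<zeta>')"
    unfolding to_germ_def p_def by (rule refl)
  ultimately show ?thesis by (simp add: p)
qed

lemma bij_to_germ: "bij_betw to_germ (characters Kstar) (carrier L.Xstar)"
proof (rule bij_betw_imageI)
  show "inj_on to_germ (characters Kstar)"
  proof (rule inj_onI)
    fix \<xi> \<eta> assume "\<xi> \<in> characters Kstar" "\<eta> \<in> characters Kstar" and eq: "to_germ \<xi> = to_germ \<eta>"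
    then obtain g \<zeta> h \<zeta>' where gz: "g \<in> carrier G" "\<zeta> \<in> characters K" "\<xi> = component_character g \<zeta>"
      "h \<in> carrier G" "\<zeta>' \<in> characters K" "\<eta> = component_character h \<zeta>'"
      by (metis component_character_surj)
    then have "L.germ g \<zeta> = L.germ h \<zeta>'" using eq by (simp add: to_germ_component_character)
    then show "\<xi> = \<eta>" unfolding gz(3,6) by (rule germ_eq_imp_component_character_eq[OF gz(1,4,2,5)])
  qed
  show "to_germ ` characters Kstar = carrier L.Xstar"
  proof (intro equalityI subsetI)
    fix Q assume "Q \<in> to_germ ` characters Kstar"
    then obtain \<xi> where \<xi>: "\<xi> \<in> characters Kstar" "Q = to_germ \<xi>" by blast
    obtain g \<zeta> where "g \<in> carrier G" "\<zeta> \<in> characters K" "\<xi> = component_character g \<zeta>"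
      using component_character_surj[OF \<xi>(1)] .
    then show "Q \<in> carrier L.Xstar" by (simp add: \<xi>(2) to_germ_component_character)
  next
    fix Q assume "Q \<in> carrier L.Xstar"
    then obtain g \<zeta> where gz: "g \<in> carrier G" "\<zeta> \<in> characters K" "Q = L.germ g \<zeta>"
      using L.in_localizationE[of Q] by auto
    then have "Q = to_germ (component_character g \<zeta>)" by (simp add: to_germ_component_character)
    then show "Q \<in> to_germ ` characters Kstar" using component_character_closed[OF gz(1,2)] by (rule image_eqI)
  qed
qed

lemma conjugated_dual_colocalization:
  "conjugated G (dual Kstar) (dual_action Kstar (colocalized_action G)) L.Xstar (localized_action G)"
proof (rule conjugatedI)
  show "topspace (tp (dual Kstar)) = carrier (dual Kstar)" by simp
  show "topspace (tp L.Xstar) = carrier L.Xstar" by simp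
  \<comment> \<open>The dual of the compact group \<open>K*\<close> is discrete, as is
    \<open>X*\<close>, so a bijection between them is automatically a homeomorphism.\<close>
  have disc: "tp (dual Kstar) = discrete_topology (characters Kstar)"
    by (rule dual_compact_discrete[OF monoid_Kstar topspace_Kstar compact_Kstar])
  show "homeomorphic_maps (tp (dual Kstar)) (tp L.Xstar) to_germ (inv_into (characters Kstar) to_germ)"
    using bij_to_germ bij_betw_inv_into[OF bij_to_germ] unfolding disc homeomorphic_maps_def
    by (simp add: bij_betw_apply Pi_iff bij_betw_inv_into_left bij_betw_inv_into_right)
  show "to_germ \<in> hom (dual Kstar) L.Xstar"
  proof (rule homI)
    fix \<xi> \<eta> assume "\<xi> \<in> carrier (dual Kstar)" "\<eta> \<in> carrier (dual Kstar)"
    then obtain g \<zeta> h \<zeta>' where gz: "g \<in> carrier G" "\<zeta> \<in> characters K" "\<xi> = component_character g \<zeta>"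
      "h \<in> carrier G" "\<zeta>' \<in> characters K" "\<eta> = component_character h \<zeta>'"
      by (metis component_character_surj carrier_dual)
    obtain m s t where m: "m \<in> carrier G" "s \<in> carrier S" "t \<in> carrier S"
      "g = m \<otimes>\<^bsub>G\<^esub> \<iota> s" "h = m \<otimes>\<^bsub>G\<^esub> \<iota> t"
      using upper_boundE[OF gz(1,4)] .
    let ?a = "dual_action K \<rho> s \<zeta>" and ?b = "dual_action K \<rho> t \<zeta>'"
    have ab: "?a \<in> characters K" "?b \<in> characters K"
      using L.lam_closed[OF m(2)] L.lam_closed[OF m(3)] gz by auto
    have \<xi>\<eta>: "\<xi> = component_character m ?a" "\<eta> = component_character m ?b" using gz m by (simp_all add: component_character_lam)
    have "component_character m ?a \<otimes>\<^bsub>dual Kstar\<^esub> component_character m ?b = component_character m (?a \<otimes>\<^bsub>dual K\<^esub> ?b)"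
      unfolding mult_dual component_character_def using m(1)
      by (intro restrict_ext) (auto simp: carrier_colocalization)
    moreover have "?a \<otimes>\<^bsub>dual K\<^esub> ?b \<in> characters K"
      using L.X.m_closed[of ?a ?b] ab by (simp only: carrier_dual)
    ultimately have "to_germ (\<xi> \<otimes>\<^bsub>dual Kstar\<^esub> \<eta>) = L.germ m (?a \<otimes>\<^bsub>dual K\<^esub> ?b)"
      unfolding \<xi>\<eta> using to_germ_component_character[OF m(1)] by (simp only:)
    also have "\<dots> = L.germ m ?a \<otimes>\<^bsub>L.Xstar\<^esub> L.germ m ?b"
      using L.mult_localization[OF m(1), of ?a ?b] ab by (simp only: carrier_dual mult_discrete_group)
    finally show "to_germ (\<xi> \<otimes>\<^bsub>dual Kstar\<^esub> \<eta>) = to_germ \<xi> \<otimes>\<^bsub>L.Xstar\<^esub> to_germ \<eta>"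
      unfolding \<xi>\<eta> using to_germ_component_character[OF m(1)] ab by (simp only:)
  qed (use bij_to_germ in \<open>auto simp: bij_betw_def\<close>)
  fix a \<xi> assume a: "a \<in> carrier G" and "\<xi> \<in> carrier (dual Kstar)"
  then obtain g \<zeta> where gz: "g \<in> carrier G" "\<zeta> \<in> characters K" "\<xi> = component_character g \<zeta>"
    using component_character_surj by (metis carrier_dual)
  have shift: "colocalized_action G a k \<in> carrier Kstar" if "k \<in> carrier Kstar" for k
    using that a by (auto simp: carrier_colocalization colocalized_action_def compatible_def G.m_assoc[symmetric])
  \<comment> \<open>The component at \<open>g\<close> of the family shifted by \<open>a\<close> is
    the original component at \<open>a g\<close>.\<close>
  have "dual_action Kstar (colocalized_action G) a \<xi> = component_character (a \<otimes>\<^bsub>G\<^esub> g) \<zeta>"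
    unfolding gz(3) dual_action_def compose_def component_character_def using shift gz(1)
    by (intro restrict_ext) (simp add: colocalized_action_def)
  then show "to_germ (dual_action Kstar (colocalized_action G) a \<xi>) = localized_action G a (to_germ \<xi>)"
    using a gz by (simp add: to_germ_component_character L.localized_action_germ)
qed

end

theorem lemma5p2:
  fixes S :: "'s monoid" and G :: "'g monoid" and \<iota> :: "'s \<Rightarrow> 'g"
    and I :: "'i set" and below :: "'i \<Rightarrow> 'i \<Rightarrow> bool" and F :: "'i \<Rightarrow> 's set"
  assumes "monoid_cancel S"
    and "right_folner_net S I below F"
    and "left_fraction_group S G \<iota>"
  shows "(\<forall>(X :: 'x monoid) (lam :: 's \<Rightarrow> 'x \<Rightarrow> 'x).
            comm_group X \<longrightarrow> left_action S X lam \<longrightarrow>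
            (let K = dual (discrete_group X);
                 \<rho> = dual_action (discrete_group X) lam;
                 Xstar = discrete_group (ore_localization S G \<iota> X lam);
                 Kstar = ore_colocalization S G \<iota> K \<rho>
             in conjugated G
                  (dual Xstar) (dual_action Xstar (localized_action G))
                  Kstar (colocalized_action G)))
       \<and> (\<forall>(K :: 'k top_group) (\<rho> :: 's \<Rightarrow> 'k \<Rightarrow> 'k).
            compact_ab_group K \<longrightarrow> right_action S K \<rho> \<longrightarrow>
            (let X = dual K;
                 lam = dual_action K \<rho>;
                 Xstar = discrete_group (ore_localization S G \<iota> X lam);
                 Kstar = ore_colocalization S G \<iota> K \<rho>
             in conjugated G
                  (dual Kstar) (dual_action Kstar (colocalized_action G))
                  Xstar (localized_action G)))"
proof -
  interpret left_fractions S G \<iota>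
    using assms(1,3)
    by (simp add: left_fractions_def left_fractions_axioms_def left_fraction_group_def monoid_cancel_def)
  show ?thesis
    unfolding Let_def
  proof (intro conjI allI impI)
    fix X :: "'x monoid" and lam :: "'s \<Rightarrow> 'x \<Rightarrow> 'x"
    assume "comm_group X" "left_action S X lam"
    then interpret ore_left_action S G \<iota> X lam
      by (intro ore_left_action.intro ore_left_action_axioms.intro left_fractions_axioms)
    show "conjugated G (dual Xstar) (dual_action Xstar (localized_action G))
        (ore_colocalization S G \<iota> (dual (discrete_group X)) (dual_action (discrete_group X) lam))
        (colocalized_action G)"
      by (rule conjugated_dual_localization)
  next
    fix K :: "'k top_group" and \<rho> :: "'s \<Rightarrow> 'k \<Rightarrow> 'k"
    assume "compact_ab_group K" "right_action S K \<rho>"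
    then interpret compact_ore_right_action S G \<iota> K \<rho>
      by (intro compact_ore_right_action.intro compact_ore_right_action_axioms.intro
          ore_right_action.intro ore_right_action_axioms.intro left_fractions_axioms)
    show "conjugated G (dual Kstar) (dual_action Kstar (colocalized_action G))
        (discrete_group (ore_localization S G \<iota> (dual K) (dual_action K \<rho>))) (localized_action G)"
      by (rule conjugated_dual_colocalization)
  qed
qed

end
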